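(* The divisorial gonality $\operatorname{gon}(G)$ of a banana path $G$ on $n+1$ vertices can be computed in $O(n^3)$ time.
   Context: Graphs are finite, connected, undirected, loopless multigraphs. A banana path is a multigraph whose underlying simple graph is a path. The divisorial gonality $\operatorname{gon}(G)$ is the minimum degree of a divisor of positive rank in the chip-firing (Baker–Norine) divisor theory on $G$. *)

theory Defs
  imports Complex_Main "HOL-Library.Landau_Symbols"
begin

section \<open>Multigraphs and banana paths\<close>

text \<open>\<open>mult G u v\<close> is the number of edges joining \<open>u\<close> and \<open>v\<close>.\<close>

record 'v multigraph =
  verts :: "'v set"
  mult :: "'v \<Rightarrow> 'v \<Rightarrow> nat"

definition connected_mg :: "'v multigraph \<Rightarrow> bool" where
  "connected_mg G \<longleftrightarrow>
     (\<forall>u\<in>verts G. \<forall>v\<in>verts G. (u, v) \<in> {(x, y). mult G x y > 0}\<^sup>*)"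

definition is_multigraph :: "'v multigraph \<Rightarrow> bool" where
  "is_multigraph G \<longleftrightarrow>
     finite (verts G) \<and> verts G \<noteq> {} \<and>
     (\<forall>u v. mult G u v > 0 \<longrightarrow> u \<in> verts G \<and> v \<in> verts G) \<and>
     (\<forall>u v. mult G u v = mult G v u) \<and>
     (\<forall>v. mult G v v = 0) \<and>
     connected_mg G"

definition simple_edges :: "'v multigraph \<Rightarrow> 'v set set" where
  "simple_edges G = {{u, v} | u v. mult G u v > 0}"

definition is_path_graph :: "'v set \<Rightarrow> 'v set set \<Rightarrow> bool" where
  "is_path_graph V E \<longleftrightarrow>
     (\<exists>p. p \<noteq> [] \<and> distinct p \<and> set p = V \<and>
          E = {{p ! i, p ! Suc i} | i. Suc i < length p})"

definition banana_path :: "'v multigraph \<Rightarrow> bool" where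
  "banana_path G \<longleftrightarrow> is_multigraph G \<and> is_path_graph (verts G) (simple_edges G)"

section \<open>Divisors, rank and gonality\<close>

definition is_divisor :: "'v multigraph \<Rightarrow> ('v \<Rightarrow> int) \<Rightarrow> bool" where
  "is_divisor G D \<longleftrightarrow> (\<forall>v. v \<notin> verts G \<longrightarrow> D v = 0)"

definition div_degree :: "'v multigraph \<Rightarrow> ('v \<Rightarrow> int) \<Rightarrow> int" where
  "div_degree G D = (\<Sum>v\<in>verts G. D v)"

definition effective :: "'v multigraph \<Rightarrow> ('v \<Rightarrow> int) \<Rightarrow> bool" where
  "effective G D \<longleftrightarrow> is_divisor G D \<and> (\<forall>v\<in>verts G. D v \<ge> 0)"

definition laplacian :: "'v multigraph \<Rightarrow> ('v \<Rightarrow> int) \<Rightarrow> 'v \<Rightarrow> int" where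
  "laplacian G f v = (\<Sum>u\<in>verts G. int (mult G v u) * (f v - f u))"

definition lin_equiv :: "'v multigraph \<Rightarrow> ('v \<Rightarrow> int) \<Rightarrow> ('v \<Rightarrow> int) \<Rightarrow> bool" where
  "lin_equiv G D D' \<longleftrightarrow> (\<exists>f. \<forall>v\<in>verts G. D' v = D v - laplacian G f v)"

definition linear_system :: "'v multigraph \<Rightarrow> ('v \<Rightarrow> int) \<Rightarrow> ('v \<Rightarrow> int) set" where
  "linear_system G D = {D'. effective G D' \<and> lin_equiv G D D'}"

text \<open>The set of \<open>k\<close> below contains \<open>0\<close> if the linear system of \<open>D\<close> is nonempty, and it is bounded
  by the degree of \<open>D\<close>, so the greatest element exists.\<close>

definition div_rank :: "'v multigraph \<Rightarrow> ('v \<Rightarrow> int) \<Rightarrow> int" where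
  "div_rank G D =
     (if linear_system G D = {} then - 1
      else int (GREATEST k. \<forall>E. effective G E \<and> div_degree G E = int k
                             \<longrightarrow> linear_system G (\<lambda>v. D v - E v) \<noteq> {}))"

text \<open>Divisors of positive rank have positive degree, so the minimum may be taken over \<^typ>\<open>nat\<close>.\<close>

definition gonality :: "'v multigraph \<Rightarrow> nat" where
  "gonality G =
     (LEAST d. \<exists>D. is_divisor G D \<and> div_degree G D = int d \<and> div_rank G D > 0)"

section \<open>Random access machines\<close>

text \<open>A unit-cost RAM with the arithmetic of Cook and Reckhow (addition and subtraction only), over
  natural numbers, so subtraction is truncated. A program addresses finitely many registers
  directly and a memory indirectly, through the contents of registers.\<close>

datatype instr =
    Const nat nat      \<comment> \<open>\<open>R[i] := c\<close>\<close>
  | Add nat nat nat    \<comment> \<open>\<open>R[i] := R[j] + R[k]\<close>\<close>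
  | Sub nat nat nat    \<comment> \<open>\<open>R[i] := R[j] - R[k]\<close>\<close>
  | Load nat nat       \<comment> \<open>\<open>R[i] := M[R[j]]\<close>\<close>
  | Store nat nat      \<comment> \<open>\<open>M[R[i]] := R[j]\<close>\<close>
  | Jump nat           \<comment> \<open>\<open>goto l\<close>\<close>
  | JumpZero nat nat   \<comment> \<open>\<open>if R[i] = 0 then goto l\<close>\<close>

text \<open>Program counter, registers, memory.\<close>

type_synonym config = "nat \<times> (nat \<Rightarrow> nat) \<times> (nat \<Rightarrow> nat)"

fun exec_instr :: "instr \<Rightarrow> config \<Rightarrow> config" where
  "exec_instr (Const i c) (pc, R, M) = (Suc pc, R(i := c), M)"
| "exec_instr (Add i j k) (pc, R, M) = (Suc pc, R(i := R j + R k), M)"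
| "exec_instr (Sub i j k) (pc, R, M) = (Suc pc, R(i := R j - R k), M)"
| "exec_instr (Load i j) (pc, R, M) = (Suc pc, R(i := M (R j)), M)"
| "exec_instr (Store i j) (pc, R, M) = (Suc pc, R, M(R i := R j))"
| "exec_instr (Jump l) (pc, R, M) = (l, R, M)"
| "exec_instr (JumpZero i l) (pc, R, M) = (if R i = 0 then l else Suc pc, R, M)"

text \<open>The machine halts when the program counter leaves the program; a halted configuration is a
  fixed point of \<open>step\<close>.\<close>

definition halted :: "instr list \<Rightarrow> config \<Rightarrow> bool" where
  "halted P c \<longleftrightarrow> fst c \<ge> length P"

definition step :: "instr list \<Rightarrow> config \<Rightarrow> config" where
  "step P c = (if halted P c then c else exec_instr (P ! fst c) c)"

definition outputs_within :: "instr list \<Rightarrow> config \<Rightarrow> nat \<Rightarrow> nat \<Rightarrow> bool" where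
  "outputs_within P c t y \<longleftrightarrow>
     (let c' = (step P ^^ t) c in halted P c' \<and> fst (snd c') 0 = y)"

text \<open>For \<open>G\<close> with vertices \<open>0, \<dots>, N - 1\<close>: register \<open>0\<close> holds \<open>N\<close> and the memory holds the
  \<open>N \<times> N\<close> matrix of edge multiplicities in row-major order. The vertices of a banana path need not
  be numbered in the order of the path.\<close>

definition input_config :: "nat multigraph \<Rightarrow> config" where
  "input_config G =
     (let N = card (verts G) in
      (0,
       (\<lambda>i. if i = 0 then N else 0),
       (\<lambda>a. if a < N * N then mult G (a div N) (a mod N) else 0)))"

end

theory Submission
  imports Defs
begin

text \<open>Number the vertices along the path and let \<open>m\<^sub>i\<close> be the multiplicity of the \<open>i\<close>-th bundle of
  edges. An effective divisor of degree \<open>d\<close> is a monotone sequence of partial sums from 0 to \<open>d\<close>,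
  and linear equivalence changes the \<open>i\<close>-th partial sum by multiples of \<open>m\<^sub>i\<close>. So the rank is
  positive iff, for every vertex, some monotone sequence in the given residue classes increases
  strictly there. It suffices to compare the least such sequence \<open>L\<close> with the greatest one \<open>U\<close>:
  the condition becomes \<open>L\<^sub>i < U\<^sub>i\<^sub>+\<^sub>1\<close> for all \<open>i\<close>. As constraints on \<open>L\<close> and \<open>U\<close> are invariant under
  translation, only the gap \<open>U\<^sub>i - L\<^sub>i\<close>, a multiple of \<open>m\<^sub>i\<close>, has to be remembered, and the least
  possible \<open>L\<^sub>i\<close> for each gap is found by dynamic programming along the path. The gonality is at
  most the number of vertices, so there are \<open>O(n)\<close> gaps and \<open>O(n\<^sup>2)\<close> transitions per vertex.\<close>

section \<open>Structured programs for the random access machine\<close>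

type_synonym state = "(nat \<Rightarrow> nat) \<times> (nat \<Rightarrow> nat)"
type_synonym code = "nat \<Rightarrow> instr list"

text \<open>Jump targets are absolute, so a fragment is a function of its start address. Quantifying
  over all surrounding programs makes executions composable.\<close>

definition runs :: "code \<Rightarrow> state \<Rightarrow> nat \<Rightarrow> state \<Rightarrow> bool" where
  "runs c s t s' \<longleftrightarrow>
     (\<forall>pre post. (step (pre @ c (length pre) @ post) ^^ t) (length pre, s) =
        (length pre + length (c (length pre)), s'))"

definition achieves :: "code \<Rightarrow> nat \<Rightarrow> ((nat \<Rightarrow> nat) \<Rightarrow> (nat \<Rightarrow> nat) \<Rightarrow> bool) \<Rightarrow>
    (nat \<Rightarrow> nat) \<Rightarrow> (nat \<Rightarrow> nat) \<Rightarrow> bool" where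
  "achieves c B Q R M \<longleftrightarrow> (\<exists>t\<le>B. \<exists>R' M'. runs c (R, M) t (R', M') \<and> Q R' M')"

definition block :: "instr list \<Rightarrow> code" where
  "block is = (\<lambda>_. is)"

definition seq :: "code \<Rightarrow> code \<Rightarrow> code" (infixr \<open>;;\<close> 60) where
  "(a ;; b) = (\<lambda>pos. a pos @ b (pos + length (a pos)))"

definition if_nonzero :: "nat \<Rightarrow> code \<Rightarrow> code" where
  "if_nonzero r c = (\<lambda>pos. let b = c (Suc pos) in JumpZero r (Suc pos + length b) # b)"

definition while_nonzero :: "nat \<Rightarrow> code \<Rightarrow> code" where
  "while_nonzero r c =
     (\<lambda>pos. let b = c (Suc pos) in JumpZero r (pos + length b + 2) # b @ [Jump pos])"

fun straight :: "instr \<Rightarrow> bool" where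
  "straight (Jump _) = False"
| "straight (JumpZero _ _) = False"
| "straight _ = True"

definition effect :: "instr \<Rightarrow> state \<Rightarrow> state" where
  "effect i s = snd (exec_instr i (0, s))"

lemma effect_simps [simp]:
  "effect (Const i c) (R, M) = (R(i := c), M)"
  "effect (Add i j k) (R, M) = (R(i := R j + R k), M)"
  "effect (Sub i j k) (R, M) = (R(i := R j - R k), M)"
  "effect (Load i j) (R, M) = (R(i := M (R j)), M)"
  "effect (Store i j) (R, M) = (R, M(R i := R j))"
  by (simp_all add: effect_def)

lemma exec_straight: "straight i \<Longrightarrow> exec_instr i (pc, s) = (Suc pc, effect i s)"
  by (cases s; cases i) (auto simp: effect_def)

lemma step_at: "step (pre @ i # post) (length pre, s) = exec_instr i (length pre, s)"
  by (simp add: step_def halted_def)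

lemma runsD:
  assumes "runs c s t s'" and "P = pre @ c pos @ post" and "pos = length pre"
  shows "(step P ^^ t) (pos, s) = (pos + length (c pos), s')"
  using assms by (auto simp: runs_def)

lemma runs_block: "list_all straight is \<Longrightarrow> runs (block is) s (length is) (fold effect is s)"
proof (induction "is" arbitrary: s)
  case Nil
  then show ?case by (simp add: runs_def block_def)
next
  case (Cons i "is")
  have "(step (pre @ (i # is) @ post) ^^ length (i # is)) (length pre, s) =
      (length pre + length (i # is), fold effect (i # is) s)" for pre post
  proof -
    have "runs (block is) (effect i s) (length is) (fold effect is (effect i s))"
      using Cons by simp
    from this[unfolded runs_def block_def, rule_format, of "pre @ [i]" post]
    have "(step (pre @ i # is @ post) ^^ length is) (Suc (length pre), effect i s) =
        (Suc (length pre) + length is, fold effect is (effect i s))"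
      by simp
    moreover have "step (pre @ i # is @ post) (length pre, s) = (Suc (length pre), effect i s)"
      using Cons.prems by (simp add: step_at exec_straight)
    ultimately show ?thesis
      by (simp add: funpow_Suc_right del: funpow.simps(2))
  qed
  then show ?case by (simp add: runs_def block_def)
qed

lemma runs_seq:
  assumes "runs a s t s'" and "runs b s' u s''"
  shows "runs (a ;; b) s (u + t) s''"
  unfolding runs_def
proof (intro allI)
  fix pre post :: "instr list"
  let ?A = "a (length pre)"
  let ?B = "b (length pre + length ?A)"
  have "(step (pre @ ?A @ ?B @ post) ^^ t) (length pre, s) = (length pre + length ?A, s')"
    using runsD[OF assms(1)] by blast
  moreover have "(step (pre @ ?A @ ?B @ post) ^^ u) (length pre + length ?A, s') =
      (length pre + length ?A + length ?B, s'')"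
    by (rule runsD[OF assms(2), where pre = "pre @ ?A" and post = post]) simp_all
  ultimately show "(step (pre @ (a ;; b) (length pre) @ post) ^^ (u + t)) (length pre, s) =
      (length pre + length ((a ;; b) (length pre)), s'')"
    by (simp add: seq_def funpow_add)
qed

lemma runs_if_zero: "R r = 0 \<Longrightarrow> runs (if_nonzero r c) (R, M) 1 (R, M)"
  by (auto simp: runs_def if_nonzero_def Let_def step_at)

lemma runs_if_nonzero:
  assumes "R r \<noteq> 0" and "runs c (R, M) t s'"
  shows "runs (if_nonzero r c) (R, M) (Suc t) s'"
  unfolding runs_def
proof (intro allI)
  fix pre post :: "instr list"
  let ?b = "c (Suc (length pre))"
  let ?J = "JumpZero r (Suc (length pre) + length ?b)"
  have "step (pre @ ?J # ?b @ post) (length pre, R, M) = (Suc (length pre), R, M)"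
    using assms(1) by (simp add: step_at)
  moreover have "(step (pre @ ?J # ?b @ post) ^^ t) (Suc (length pre), R, M) =
      (Suc (length pre) + length ?b, s')"
    by (rule runsD[OF assms(2), where pre = "pre @ [?J]" and post = post]) simp_all
  ultimately show "(step (pre @ if_nonzero r c (length pre) @ post) ^^ Suc t) (length pre, R, M) =
      (length pre + length (if_nonzero r c (length pre)), s')"
    by (simp add: if_nonzero_def Let_def funpow_Suc_right del: funpow.simps(2))
qed

lemma runs_while_zero: "R r = 0 \<Longrightarrow> runs (while_nonzero r c) (R, M) 1 (R, M)"
  by (auto simp: runs_def while_nonzero_def Let_def step_at)

text \<open>Read from right to left, the time consists of the test, the body, the jump back and the
  remaining iterations, in the order in which \<open>funpow_add\<close> splits them off.\<close>

lemma runs_while_nonzero: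
  assumes "R r \<noteq> 0" and "runs c (R, M) t s" and "runs (while_nonzero r c) s u s'"
  shows "runs (while_nonzero r c) (R, M) (u + (1 + (t + 1))) s'"
  unfolding runs_def
proof (intro allI)
  fix pre post :: "instr list"
  let ?n = "length pre"
  let ?b = "c (Suc ?n)"
  let ?J = "JumpZero r (?n + length ?b + 2)"
  let ?P = "pre @ ?J # ?b @ Jump ?n # post"
  have P: "pre @ while_nonzero r c ?n @ post = ?P"
    by (simp add: while_nonzero_def Let_def)
  have 1: "step ?P (?n, R, M) = (Suc ?n, R, M)"
    using assms(1) by (simp add: step_at)
  have 2: "(step ?P ^^ t) (Suc ?n, R, M) = (Suc ?n + length ?b, s)"
    by (rule runsD[OF assms(2), where pre = "pre @ [?J]" and post = "Jump ?n # post"]) simp_all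
  have 3: "step ?P (Suc ?n + length ?b, s) = (?n, s)"
    using step_at[of "pre @ ?J # ?b" "Jump ?n" post s] by (cases s) simp
  have 4: "(step ?P ^^ u) (?n, s) = (?n + length (while_nonzero r c ?n), s')"
    by (rule runsD[OF assms(3), where post = post]) (simp_all add: P)
  show "(step (pre @ while_nonzero r c ?n @ post) ^^ (u + (1 + (t + 1)))) (?n, R, M) =
      (?n + length (while_nonzero r c ?n), s')"
    unfolding P funpow_add using 1 2 3 4 by simp
qed

section \<open>Postconditions with time bounds\<close>

lemma achieves_mono:
  "\<lbrakk>achieves c B Q R M; B \<le> B'; \<And>R' M'. Q R' M' \<Longrightarrow> Q' R' M'\<rbrakk> \<Longrightarrow> achieves c B' Q' R M"
  unfolding achieves_def by (meson order_trans)

lemma achieves_block: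
  assumes "list_all straight is" and "case_prod Q (fold effect is (R, M))"
  shows "achieves (block is) (length is) Q R M"
  using runs_block[OF assms(1), of "(R, M)"] assms(2) unfolding achieves_def
  by (cases "fold effect is (R, M)") auto

lemma achieves_seq:
  assumes "achieves a A (achieves b B Q) R M"
  shows "achieves (a ;; b) (A + B) Q R M"
proof -
  obtain t R' M' where 1: "t \<le> A" "runs a (R, M) t (R', M')" "achieves b B Q R' M'"
    using assms unfolding achieves_def by blast
  then obtain u R'' M'' where 2: "u \<le> B" "runs b (R', M') u (R'', M'')" "Q R'' M''"
    unfolding achieves_def by blast
  have "u + t \<le> A + B"
    using 1 2 by simp
  then show ?thesis
    using runs_seq[OF 1(2) 2(2)] 2(3) unfolding achieves_def by blast
qed

lemma achieves_block_le:
  assumes "list_all straight is" and "length is \<le> B" and "case_prod Q (fold effect is (R, M))"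
  shows "achieves (block is) B Q R M"
  by (rule achieves_mono[OF achieves_block[OF assms(1,3)] assms(2)])

lemma achieves_seq_le:
  assumes "achieves a A Q' R M" and "\<And>R' M'. Q' R' M' \<Longrightarrow> achieves b B Q R' M'" and "A + B \<le> C"
  shows "achieves (a ;; b) C Q R M"
  by (rule achieves_mono[OF achieves_seq assms(3)])
    (rule achieves_mono[OF assms(1) order_refl assms(2)])

lemma achieves_block_seq:
  assumes "list_all straight is" and "length is + B \<le> C"
    and "case_prod (achieves b B Q) (fold effect is (R, M))"
  shows "achieves (block is ;; b) C Q R M"
  by (rule achieves_mono[OF achieves_seq[OF achieves_block[OF assms(1,3)]] assms(2)])

lemma achieves_if_nonzero:
  assumes "R r \<noteq> 0 \<Longrightarrow> achieves c B Q R M" and "R r = 0 \<Longrightarrow> Q R M"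
  shows "achieves (if_nonzero r c) (Suc B) Q R M"
proof (cases "R r = 0")
  case True
  show ?thesis
    using runs_if_zero[of R r c M] True assms(2)[OF True] unfolding achieves_def
    by (metis One_nat_def Suc_le_mono le0)
next
  case False
  then show ?thesis
    using runs_if_nonzero[of R r c M] False assms(1)[OF False] unfolding achieves_def
    by (metis Suc_le_mono)
qed

text \<open>The invariant is indexed by the number of completed iterations, so termination after
  exactly \<open>K\<close> rounds needs no separate measure. Each round pays 2 for the test and the
  jump back; the last 1 is the failing test.\<close>

lemma achieves_while:
  assumes "I 0 R M"
    and body: "\<And>k R M. \<lbrakk>k < K; I k R M\<rbrakk> \<Longrightarrow> R r \<noteq> 0 \<and> achieves c B (I (Suc k)) R M"
    and exit: "\<And>R M. I K R M \<Longrightarrow> R r = 0 \<and> Q R M"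
  shows "achieves (while_nonzero r c) (K * (B + 2) + 1) Q R M"
proof -
  have "achieves (while_nonzero r c) (d * (B + 2) + 1) Q R M"
    if "k + d = K" "I k R M" for d k R M
    using that
  proof (induction d arbitrary: k R M)
    case 0
    then have "R r = 0" "Q R M"
      using exit by auto
    then show ?case
      using runs_while_zero[of R r c M] unfolding achieves_def by (metis add_0 mult_0 order_refl)
  next
    case (Suc d)
    then have nz: "R r \<noteq> 0" and "achieves c B (I (Suc k)) R M"
      using body[of k R M] by auto
    then obtain t R' M' where 1: "t \<le> B" "runs c (R, M) t (R', M')" "I (Suc k) R' M'"
      unfolding achieves_def by blast
    have "achieves (while_nonzero r c) (d * (B + 2) + 1) Q R' M'"
      using Suc.IH[of "Suc k"] Suc.prems 1 by simp
    then obtain u R'' M'' where 2: "u \<le> d * (B + 2) + 1"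
      "runs (while_nonzero r c) (R', M') u (R'', M'')" "Q R'' M''"
      unfolding achieves_def by blast
    have "u + (1 + (t + 1)) \<le> Suc d * (B + 2) + 1"
      using 1 2 by simp
    then show ?case
      using runs_while_nonzero[of R r, OF nz 1(2) 2(2)] 2(3) unfolding achieves_def by blast
  qed
  then show ?thesis
    using assms(1) by (metis add_0)
qed

text \<open>A halted configuration is a fixed point of \<open>step\<close>, so an upper bound on the
  time is as good as the exact time.\<close>

lemma outputs_within_achieves:
  assumes "achieves c B (\<lambda>R' M'. R' 0 = y) R M" and "B \<le> T"
  shows "outputs_within (c 0) (0, R, M) T y"
proof -
  obtain t R' M' where t: "t \<le> B" "runs c (R, M) t (R', M')" "R' 0 = y"
    using assms(1) unfolding achieves_def by blast
  have t': "(step (c 0) ^^ t) (0, R, M) = (length (c 0), R', M')"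
    using runsD[OF t(2), where P = "c 0" and pre = "[]" and post = "[]" and pos = 0] by simp
  have stay: "(step (c 0) ^^ u) (length (c 0), R', M') = (length (c 0), R', M')" for u
    by (induction u) (auto simp: step_def halted_def)
  have "T = (T - t) + t"
    using t(1) assms(2) by simp
  then have "(step (c 0) ^^ T) (0, R, M) = (length (c 0), R', M')"
    using t' stay by (metis comp_apply funpow_add)
  then show ?thesis
    using t(3) by (simp add: outputs_within_def halted_def)
qed

section \<open>Positive rank\<close>

text \<open>Exchanging the sums and using the symmetry of \<open>mult\<close> makes the two halves
  cancel.\<close>

lemma laplacian_sum_eq_0:
  assumes "is_multigraph G"
  shows "(\<Sum>v\<in>verts G. laplacian G f v) = 0"
proof -
  let ?V = "verts G"
  have sym: "mult G u v = mult G v u" for u v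
    using assms by (simp add: is_multigraph_def)
  have "(\<Sum>v\<in>?V. \<Sum>u\<in>?V. int (mult G v u) * f u) = (\<Sum>u\<in>?V. \<Sum>v\<in>?V. int (mult G v u) * f u)"
    by (rule sum.swap)
  also have "\<dots> = (\<Sum>v\<in>?V. \<Sum>u\<in>?V. int (mult G v u) * f v)"
    by (intro sum.cong refl) (metis sym)
  finally show ?thesis
    by (simp add: laplacian_def right_diff_distrib sum_subtractf)
qed

lemma lin_equiv_degree:
  assumes "is_multigraph G" and "lin_equiv G D D'"
  shows "div_degree G D' = div_degree G D"
proof -
  obtain f where "\<forall>v\<in>verts G. D' v = D v - laplacian G f v"
    using assms(2) by (auto simp: lin_equiv_def)
  then have "div_degree G D' = (\<Sum>v\<in>verts G. D v - laplacian G f v)"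
    by (simp add: div_degree_def)
  then show ?thesis
    by (simp add: sum_subtractf laplacian_sum_eq_0[OF assms(1)] div_degree_def)
qed

definition point :: "'v \<Rightarrow> 'v \<Rightarrow> int" where
  "point w = (\<lambda>v. if v = w then 1 else 0)"

lemma point_degree: "finite (verts G) \<Longrightarrow> w \<in> verts G \<Longrightarrow> div_degree G (point w) = 1"
  by (simp add: div_degree_def point_def)

text \<open>The other \<open>k\<close> chips can be put back on \<open>w\<close> without losing
  effectivity.\<close>

lemma linear_system_minus_less:
  assumes "linear_system G (\<lambda>v. D v - int (Suc k) * point w v) \<noteq> {}" and "w \<in> verts G"
  shows "linear_system G (\<lambda>v. D v - point w v) \<noteq> {}"
proof -
  obtain D' where "effective G D'" "lin_equiv G (\<lambda>v. D v - int (Suc k) * point w v) D'"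
    using assms(1) by (auto simp: linear_system_def)
  then have "effective G (\<lambda>v. D' v + int k * point w v)"
    "lin_equiv G (\<lambda>v. D v - point w v) (\<lambda>v. D' v + int k * point w v)"
    using assms(2) by (auto simp: effective_def is_divisor_def lin_equiv_def point_def)
  then show ?thesis
    by (auto simp: linear_system_def)
qed

lemma effective_degree_one:
  assumes "finite (verts G)" and "effective G E" and "div_degree G E = 1"
  obtains w where "w \<in> verts G" and "E = point w"
proof -
  have nonneg: "\<And>v. v \<in> verts G \<Longrightarrow> 0 \<le> E v" and out: "\<And>v. v \<notin> verts G \<Longrightarrow> E v = 0"
    using assms(2) by (auto simp: effective_def is_divisor_def)
  have "\<exists>w\<in>verts G. E w \<noteq> 0"
    using assms(3) unfolding div_degree_def by (metis sum.neutral zero_neq_one)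
  then obtain w where w: "w \<in> verts G" "E w > 0"
    using nonneg by (metis order_le_imp_less_or_eq)
  have "E w + (\<Sum>v\<in>verts G - {w}. E v) = 1"
    using assms(1,3) w(1) by (simp add: div_degree_def sum.remove)
  moreover have "0 \<le> (\<Sum>v\<in>verts G - {w}. E v)"
    by (rule sum_nonneg) (use nonneg in auto)
  ultimately have "E w = 1" and "(\<Sum>v\<in>verts G - {w}. E v) = 0"
    using w(2) by linarith+
  then have "\<forall>v\<in>verts G - {w}. E v = 0"
    using sum_nonneg_eq_0_iff[of "verts G - {w}" E] assms(1) nonneg by auto
  then have "E = point w"
    using \<open>E w = 1\<close> out by (auto simp: point_def fun_eq_iff)
  then show ?thesis
    using w(1) that by blast
qed

text \<open>To evaluate \<open>GREATEST\<close>, the property must hold somewhere and be bounded.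
  Passing from any positive \<open>k\<close> down to 1 only takes test divisors concentrated in one
  vertex, since effective divisors of degree 1 are single points.\<close>

lemma div_rank_pos_iff:
  assumes "is_multigraph G"
  shows "div_rank G D > 0 \<longleftrightarrow> (\<forall>w\<in>verts G. linear_system G (\<lambda>v. D v - point w v) \<noteq> {})"
proof -
  define P where "P k \<longleftrightarrow> (\<forall>E. effective G E \<and> div_degree G E = int k
      \<longrightarrow> linear_system G (\<lambda>v. D v - E v) \<noteq> {})" for k
  obtain w where fin: "finite (verts G)" and w: "w \<in> verts G"
    using assms by (auto simp: is_multigraph_def)
  have mult: "effective G (\<lambda>v. int k * point u v)" "div_degree G (\<lambda>v. int k * point u v) = int k"
    if "u \<in> verts G" for u k
    using that point_degree[OF fin, of u]
    by (auto simp: effective_def is_divisor_def point_def div_degree_def simp flip: sum_distrib_left)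
  \<comment> \<open>Testing with \<open>k\<close> chips on one vertex shows that \<open>k\<close>
    cannot exceed the degree.\<close>
  have bound: "k \<le> nat (div_degree G D)" if "P k" for k
  proof -
    obtain D' where "effective G D'" "lin_equiv G (\<lambda>v. D v - int k * point w v) D'"
      using \<open>P k\<close> mult[OF w, of k] by (fastforce simp: P_def linear_system_def)
    then have "0 \<le> div_degree G D'"
      by (auto simp: effective_def div_degree_def intro: sum_nonneg)
    moreover have "div_degree G D' = div_degree G (\<lambda>v. D v - int k * point w v)"
      using lin_equiv_degree[OF assms] \<open>lin_equiv G _ D'\<close> by blast
    moreover have "div_degree G (\<lambda>v. D v - int k * point w v) = div_degree G D - int k"
      using mult(2)[OF w, of k] by (simp add: div_degree_def sum_subtractf)
    ultimately show ?thesis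
      by simp
  qed
  have one: "P 1 \<longleftrightarrow> (\<forall>w\<in>verts G. linear_system G (\<lambda>v. D v - point w v) \<noteq> {})"
  proof
    show "P 1 \<Longrightarrow> \<forall>w\<in>verts G. linear_system G (\<lambda>v. D v - point w v) \<noteq> {}"
      using mult[of _ 1] by (simp add: P_def)
    show "\<forall>w\<in>verts G. linear_system G (\<lambda>v. D v - point w v) \<noteq> {} \<Longrightarrow> P 1"
      unfolding P_def using effective_degree_one[OF fin] by (metis of_nat_1)
  qed
  have down: "P 1" if "P (Suc k)" for k
    unfolding one
  proof
    fix u assume u: "u \<in> verts G"
    have "linear_system G (\<lambda>v. D v - int (Suc k) * point u v) \<noteq> {}"
      using \<open>P (Suc k)\<close> mult[OF u, of "Suc k"] unfolding P_def by blast
    then show "linear_system G (\<lambda>v. D v - point u v) \<noteq> {}"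
      using u by (rule linear_system_minus_less)
  qed
  show ?thesis
  proof (cases "linear_system G D = {}")
    case True
    \<comment> \<open>Adding the removed chip back would give an element of the empty linear system
      of \<open>D\<close>.\<close>
    have "\<not> P 1"
    proof
      assume "P 1"
      then obtain D' where "effective G D'" "lin_equiv G (\<lambda>v. D v - point w v) D'"
        using one w by (fastforce simp: linear_system_def)
      then have "effective G (\<lambda>v. D' v + point w v)" "lin_equiv G D (\<lambda>v. D' v + point w v)"
        using w by (auto simp: effective_def is_divisor_def lin_equiv_def point_def)
      then show False
        using True by (auto simp: linear_system_def)
    qed
    then show ?thesis
      using True one by (simp add: div_rank_def)
  next
    case False
    have rank: "div_rank G D = int (Greatest P)"
      using False by (simp add: div_rank_def P_def[abs_def])
    show ?thesis
    proof
      assume "div_rank G D > 0"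
      then obtain k where k: "Greatest P = Suc k"
        using rank not0_implies_Suc by fastforce
      \<comment> \<open>The only effective divisor of degree 0 is zero, so \<open>P 0\<close> is the
        nonemptiness of the linear system.\<close>
      have "(\<lambda>v. D v - E v) = D" if "effective G E" "div_degree G E = 0" for E
        using that sum_nonneg_eq_0_iff[OF fin, of E]
        by (fastforce simp: effective_def is_divisor_def div_degree_def)
      then have "P 0"
        using False by (simp add: P_def)
      then have "P (Suc k)"
        using GreatestI_nat[of P 0, OF _ bound] k by metis
      then show "\<forall>w\<in>verts G. linear_system G (\<lambda>v. D v - point w v) \<noteq> {}"
        using down one by blast
    next
      assume "\<forall>w\<in>verts G. linear_system G (\<lambda>v. D v - point w v) \<noteq> {}"
      then have "1 \<le> Greatest P"
        using one Greatest_le_nat[of P 1, OF _ bound] by blast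
      then show "div_rank G D > 0"
        using rank by simp
    qed
  qed
qed

section \<open>Chains of partial sums\<close>

text \<open>The modulus 0 at both ends of a path turns the congruences into equations.\<close>

definition chain :: "nat \<Rightarrow> (nat \<Rightarrow> nat) \<Rightarrow> (nat \<Rightarrow> int) \<Rightarrow> (nat \<Rightarrow> int) \<Rightarrow> bool" where
  "chain n m s S \<longleftrightarrow> (\<forall>i\<le>n. S i \<le> S (Suc i)) \<and> (\<forall>i\<le>Suc n. int (m i) dvd S i - s i)"

text \<open>Here \<open>l\<close> and \<open>l + g\<close> stand for the least and the greatest value of a chain at \<open>j\<close>. The last
  premise says that the chain which switches from the least to the greatest values after \<open>j\<close>
  increases strictly there.\<close>

inductive reach :: "(nat \<Rightarrow> nat) \<Rightarrow> nat \<Rightarrow> nat \<Rightarrow> nat \<Rightarrow> bool" for m where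
  reach_0: "reach m 0 0 0"
| reach_Suc: "\<lbrakk>reach m j g l; h + x = g + y; m (Suc j) dvd h; 0 < h + x\<rbrakk>
    \<Longrightarrow> reach m (Suc j) h (l + x)"

text \<open>Unfolds the recorded pairs into the two sequences they abbreviate. The new values are
  \<open>l + x\<close> and \<open>l + x + h\<close>; the latter equals \<open>l + g + y\<close>, so
  \<open>U\<close> does not decrease.\<close>

lemma reach_sequences:
  assumes "reach m j g l"
  shows "\<exists>L U :: nat \<Rightarrow> int. L 0 = 0 \<and> L j = int l \<and> U j = int (l + g) \<and>
    (\<forall>i<j. L i \<le> L (Suc i) \<and> U i \<le> U (Suc i) \<and> L i < U (Suc i)) \<and>
    (\<forall>i\<le>j. int (m i) dvd U i - L i)"
  using assms
proof induction
  case reach_0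
  show ?case
    by (rule exI[of _ "\<lambda>_. 0"], rule exI[of _ "\<lambda>_. 0"]) simp
next
  case (reach_Suc j g l h x y)
  then obtain L U :: "nat \<Rightarrow> int" where LU: "L 0 = 0" "L j = int l" "U j = int (l + g)"
    "\<And>i. i < j \<Longrightarrow> L i \<le> L (Suc i) \<and> U i \<le> U (Suc i) \<and> L i < U (Suc i)"
    "\<And>i. i \<le> j \<Longrightarrow> int (m i) dvd U i - L i"
    by blast
  let ?L = "L(Suc j := int (l + x))" and ?U = "U(Suc j := int (l + x + h))"
  have "?L i \<le> ?L (Suc i) \<and> ?U i \<le> ?U (Suc i) \<and> ?L i < ?U (Suc i)" if "i < Suc j" for i
    using LU that reach_Suc.hyps by (cases "i = j") auto
  moreover have "int (m i) dvd ?U i - ?L i" if "i \<le> Suc j" for i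
    using LU(5) that reach_Suc.hyps by (cases "i = Suc j") auto
  ultimately show ?case
    using LU(1) by (intro exI[of _ ?L] exI[of _ ?U]) auto
qed

text \<open>The sequence \<open>L\<close> itself serves as \<open>s\<close>. Following
  \<open>L\<close> up to \<open>a\<close> and \<open>U\<close> afterwards is again a chain, and it
  jumps strictly after \<open>a\<close>.\<close>

lemma reach_imp_chains:
  assumes "reach m (Suc n) 0 d"
  shows "\<exists>s. s 0 = 0 \<and> s (Suc n) = int d \<and>
    (\<forall>a\<le>n. \<exists>S. chain n m s S \<and> S a < S (Suc a))"
proof -
  obtain L U :: "nat \<Rightarrow> int" where LU: "L 0 = 0" "L (Suc n) = int d" "U (Suc n) = int d"
    "\<And>i. i \<le> n \<Longrightarrow> L i \<le> L (Suc i) \<and> U i \<le> U (Suc i) \<and> L i < U (Suc i)"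
    "\<And>i. i \<le> Suc n \<Longrightarrow> int (m i) dvd U i - L i"
    using reach_sequences[OF assms] by (auto simp: less_Suc_eq_le)
  have "\<exists>S. chain n m L S \<and> S a < S (Suc a)" if "a \<le> n" for a
  proof -
    let ?S = "\<lambda>i. if i \<le> a then L i else U i"
    have "?S i \<le> ?S (Suc i)" if "i \<le> n" for i
      using LU(4)[OF that] by (cases i a rule: linorder_cases) auto
    then have "chain n m L ?S"
      using LU(5) by (auto simp: chain_def)
    moreover have "?S a < ?S (Suc a)"
      using LU(4)[OF that] by simp
    ultimately show ?thesis
      by blast
  qed
  then show ?thesis
    using LU(1,2) by blast
qed

text \<open>Covers the modulus 0 of the two ends, where \<open>r mod 0 = r\<close>.\<close>

lemma mod_bounds:
  fixes k r :: int
  assumes "0 \<le> r" and "0 \<le> k"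
  shows "0 \<le> r mod k" and "r mod k \<le> r"
proof -
  show "0 \<le> r mod k"
    using assms by (cases "k = 0") simp_all
  show "r mod k \<le> r"
    using assms by (simp add: zmod_le_nonneg_dividend)
qed

text \<open>Greedy choices give the least sequence \<open>L\<close> from the left and the greatest
  sequence \<open>U\<close> from the right. Every chain lies between them, so a chain that is strict
  after \<open>i\<close> forces \<open>L i < U (Suc i)\<close>.\<close>

lemma chains_imp_reach:
  assumes m: "m 0 = 0" "m (Suc n) = 0" and s: "s 0 = 0"
    and chains: "\<And>a. a \<le> n \<Longrightarrow> \<exists>S. chain n m s S \<and> S a < S (Suc a)"
  shows "reach m (Suc n) 0 (nat (s (Suc n)))"
proof -
  \<comment> \<open>The next value is the least number that is at least \<open>l\<close> and lies in
    the prescribed residue class; modulus 0 yields \<open>s (Suc i)\<close> itself.\<close>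
  define L where "L = rec_nat 0 (\<lambda>i l. l + (s (Suc i) - l) mod int (m (Suc i)))"
  have L0: "L 0 = 0" and LS: "L (Suc i) = L i + (s (Suc i) - L i) mod int (m (Suc i))" for i
    by (simp_all add: L_def)
  \<comment> \<open>\<open>V\<close> is indexed by the distance from the right end, which makes the
    downward recursion for \<open>U\<close> primitive.\<close>
  define V where "V = rec_nat (s (Suc n)) (\<lambda>i u. u - (u - s (n - i)) mod int (m (n - i)))"
  define U where "U i = V (Suc n - i)" for i
  have Utop: "U (Suc n) = s (Suc n)"
    by (simp add: U_def V_def)
  have US: "U i = U (Suc i) - (U (Suc i) - s i) mod int (m i)" if "i \<le> n" for i
  proof -
    have "Suc n - i = Suc (n - i)" "n - (n - i) = i" "Suc n - Suc i = n - i"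
      using that by auto
    then show ?thesis
      by (simp add: U_def V_def)
  qed
  \<comment> \<open>Divisibility by 0 pins down the value of every chain at both ends.\<close>
  have Sends: "S 0 = 0" "S (Suc n) = s (Suc n)" if "chain n m s S" for S
    using that m s unfolding chain_def by (metis dvd_0_left_iff eq_iff_diff_eq_0 le0 of_nat_0 order_refl)+
  have low: "L i \<le> S i \<and> L i + (s (Suc i) - L i) mod int (m (Suc i)) \<le> S (Suc i) \<and>
      0 \<le> (s (Suc i) - L i) mod int (m (Suc i))" if "chain n m s S" "i \<le> n" for S i
    using that(2)
  proof (induction i)
    \<comment> \<open>\<open>S (Suc i) - L i\<close> is nonnegative and has the same residue as
      \<open>s (Suc i) - L i\<close>, so it is at least that residue.\<close>
    have *: "L i + (s (Suc i) - L i) mod int (m (Suc i)) \<le> S (Suc i) \<and>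
      0 \<le> (s (Suc i) - L i) mod int (m (Suc i))" if "L i \<le> S i" "i \<le> n" for i
    proof -
      have "L i \<le> S (Suc i)" and "int (m (Suc i)) dvd S (Suc i) - s (Suc i)"
        using that \<open>chain n m s S\<close> by (force simp: chain_def)+
      then have "(s (Suc i) - L i) mod int (m (Suc i)) = (S (Suc i) - L i) mod int (m (Suc i))"
        by (intro mod_eq_dvd_iff[THEN iffD2]) (simp add: dvd_diff_commute)
      then show ?thesis
        using mod_bounds[of "S (Suc i) - L i" "int (m (Suc i))"] \<open>L i \<le> S (Suc i)\<close> by simp
    qed
    {
      case 0
      then show ?case
        using *[of 0] L0 Sends[OF \<open>chain n m s S\<close>] by simp
    next
      case (Suc i)
      then have "L (Suc i) \<le> S (Suc i)"
        by (simp add: LS)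
      then show ?case
        using *[of "Suc i"] Suc.prems by simp
    }
  qed
  have high: "S i \<le> U i \<and> (i \<le> n \<longrightarrow> U i \<le> U (Suc i))" if "chain n m s S" "i \<le> Suc n" for S i
    using that(2)
  \<comment> \<open>Downward induction, starting at the right end where \<open>S\<close> and
    \<open>U\<close> agree.\<close>
  proof (induction rule: inc_induct)
    case base
    then show ?case
      using Utop Sends[OF that(1)] by simp
  next
    case (step i)
    then have "i \<le> n" and "S i \<le> S (Suc i)" and dvd: "int (m i) dvd S i - s i"
      using that(1) by (simp_all add: chain_def)
    then have "S i \<le> U (Suc i)"
      using step.IH by linarith
    have "(U (Suc i) - s i) mod int (m i) = (U (Suc i) - S i) mod int (m i)"
      using dvd by (intro mod_eq_dvd_iff[THEN iffD2]) simp
    then show ?case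
      using mod_bounds[of "U (Suc i) - S i" "int (m i)"] \<open>S i \<le> U (Suc i)\<close> US[OF \<open>i \<le> n\<close>] by simp
  qed
  obtain S where S: "chain n m s S"
    using chains by blast
  have Lend: "L (Suc n) = s (Suc n)"
    by (simp add: LS m)
  have "U 0 = 0"
    using US[of 0] m s by simp
  have Lmono: "L i \<le> L (Suc i)" if "i \<le> n" for i
    using low[OF S that] by (simp add: LS)
  have LU: "L i \<le> U i" if "i \<le> Suc n" for i
    using that low[OF S, of i] high[OF S, of i] Lend Utop by (cases "i = Suc n") auto
  have strict: "L i < U (Suc i)" if i: "i \<le> n" for i
  proof -
    obtain S where "chain n m s S" "S i < S (Suc i)"
      using chains[OF i] by blast
    then show ?thesis
      using low[of S i] high[of S "Suc i"] i by fastforce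
  qed
  have dvd: "int (m i) dvd U i - L i" if "i \<le> Suc n" for i
  proof -
    have "int (m i) dvd U i - s i"
    proof (cases "i = Suc n")
      case False
      then have "U i - s i = (U (Suc i) - s i) - (U (Suc i) - s i) mod int (m i)"
        using US[of i] that by simp
      then show ?thesis
        by (metis dvd_minus_mod)
    qed (simp add: Utop)
    moreover have "int (m i) dvd L i - s i"
    proof (cases i)
      case (Suc k)
      have "s i - L i = (s i - L k) - (s i - L k) mod int (m i)"
        by (simp add: Suc LS)
      then show ?thesis
        by (metis dvd_diff_commute dvd_minus_mod)
    qed (simp add: L0 s)
    ultimately have "int (m i) dvd (U i - s i) - (L i - s i)"
      by (rule dvd_diff)
    then show ?thesis
      by simp
  qed
  have "0 \<le> L i" if "i \<le> Suc n" for i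
    using that by (induction i) (use L0 Lmono in fastforce)+
  have "reach m i (nat (U i - L i)) (nat (L i))" if "i \<le> Suc n" for i
    using that
  proof (induction i)
    case 0
    then show ?case
      using reach_0 L0 \<open>U 0 = 0\<close> by simp
  next
    case (Suc i)
    then have i: "i \<le> n" "i \<le> Suc n"
      by auto
    have "reach m (Suc i) (nat (U (Suc i) - L (Suc i))) (nat (L i) + nat (L (Suc i) - L i))"
    proof (rule reach_Suc)
      show "reach m i (nat (U i - L i)) (nat (L i))"
        using Suc i by simp
      \<comment> \<open>Here \<open>x\<close> is the increase of \<open>L\<close> and
        \<open>y\<close> that of \<open>U\<close>.\<close>
      show "nat (U (Suc i) - L (Suc i)) + nat (L (Suc i) - L i) =
          nat (U i - L i) + nat (U (Suc i) - U i)"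
        using LU[OF i(2)] LU[OF Suc.prems] Lmono[OF i(1)] high[OF S i(2)] i(1) by linarith
      show "m (Suc i) dvd nat (U (Suc i) - L (Suc i))"
        using dvd[OF Suc.prems] LU[OF Suc.prems] by (simp flip: int_dvd_int_iff)
      show "0 < nat (U (Suc i) - L (Suc i)) + nat (L (Suc i) - L i)"
        using strict[OF i(1)] by linarith
    qed
    moreover have "nat (L i) + nat (L (Suc i) - L i) = nat (L (Suc i))"
      using \<open>\<And>i. i \<le> Suc n \<Longrightarrow> 0 \<le> L i\<close>[OF i(2)] Lmono[OF i(1)] by linarith
    ultimately show ?case
      by simp
  qed
  from this[of "Suc n"] show ?thesis
    by (simp add: Lend Utop)
qed

section \<open>Dynamic programming\<close>

text \<open>The least \<open>x\<close> allowed by \<open>reach_Suc\<close> between the gaps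
  \<open>g\<close> and \<open>h\<close>. The second summand is 1 only for \<open>g = h = 0\<close>,
  where strictness forces both sequences to rise.\<close>

definition descent :: "nat \<Rightarrow> nat \<Rightarrow> nat" where
  "descent g h = (g - h) + (1 - (g + h))"

text \<open>The least \<open>l\<close> with \<open>reach m j g l\<close> is stored as \<open>N + 1 - l\<close>, so that 0 stands for infinity and
  unused memory of the machine needs no initialization. Optimality of the entry is only guaranteed if
  \<open>l + g \<le> N\<close>.\<close>

fun table :: "(nat \<Rightarrow> nat) \<Rightarrow> nat \<Rightarrow> nat \<Rightarrow> nat \<Rightarrow> nat" where
  "table m N 0 g = (if g = 0 then Suc N else 0)"
| "table m N (Suc j) h = (if m (Suc j) dvd h
     then Max (insert 0 ((\<lambda>g. table m N j g - descent g h) ` {..<Suc N})) else 0)"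

lemma table_sound:
  "0 < table m N j g \<Longrightarrow> table m N j g \<le> Suc N \<and> reach m j g (Suc N - table m N j g)"
proof (induction j arbitrary: g)
  case 0
  then show ?case
    by (simp add: reach_0 split: if_splits)
next
  case (Suc j h)
  let ?A = "insert 0 ((\<lambda>g. table m N j g - descent g h) ` {..<Suc N})"
  have dvd: "m (Suc j) dvd h" and eq: "table m N (Suc j) h = Max ?A"
    using Suc.prems by (auto split: if_splits)
  \<comment> \<open>The maximum is positive, so it is attained by a predecessor \<open>g\<close> and
    not by the inserted 0.\<close>
  have "Max ?A \<in> ?A"
    by (rule Max_in) auto
  then obtain g where g: "table m N (Suc j) h = table m N j g - descent g h"
    using Suc.prems eq by auto
  then have IH: "table m N j g \<le> Suc N" "reach m j g (Suc N - table m N j g)"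
    using Suc.IH[of g] Suc.prems by auto
  have "reach m (Suc j) h (Suc N - table m N j g + descent g h)"
    \<comment> \<open>The formula is balanced:
      \<open>h + descent g h = g + descent h g\<close>.\<close>
    by (rule reach_Suc[OF IH(2), where y = "descent h g"]) (use dvd in \<open>auto simp: descent_def\<close>)
  moreover have "Suc N - table m N j g + descent g h = Suc N - table m N (Suc j) h"
    using g IH(1) Suc.prems by linarith
  moreover have "table m N (Suc j) h \<le> Suc N"
    using g IH(1) by linarith
  ultimately show ?case
    by metis
qed

text \<open>The upper value \<open>l + g\<close> never decreases along \<open>reach\<close>, so the
  bound \<open>N\<close> passes to all predecessors and keeps their gaps within the range of the
  maximum.\<close>

lemma table_complete:
  "reach m j g l \<Longrightarrow> l + g \<le> N \<Longrightarrow> Suc N - l \<le> table m N j g"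
proof (induction rule: reach.induct)
  case reach_0
  show ?case by simp
next
  case (reach_Suc j g l h x y)
  let ?A = "insert 0 ((\<lambda>g. table m N j g - descent g h) ` {..<Suc N})"
  have "l + g \<le> N"
    using reach_Suc.hyps(2) reach_Suc.prems by linarith
  then have "Suc N - l \<le> table m N j g" and "g < Suc N"
    using reach_Suc.IH by auto
  moreover have "descent g h \<le> x"
    using reach_Suc.hyps by (auto simp: descent_def)
  ultimately have "Suc N - (l + x) \<le> table m N j g - descent g h"
    by linarith
  also have "\<dots> \<le> Max ?A"
    by (rule Max_ge) (use \<open>g < Suc N\<close> in auto)
  finally show ?case
    using reach_Suc.hyps(3) by simp
qed

section \<open>Banana paths\<close>

locale listed_banana_path =
  fixes G :: "'v multigraph" and p :: "'v list" and n :: nat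
  assumes multigraph: "is_multigraph G"
    and distinct: "distinct p" and set_p: "set p = verts G" and length_p: "length p = Suc n"
    and adjacent: "\<And>i j. \<lbrakk>i \<le> n; j \<le> n\<rbrakk> \<Longrightarrow> 0 < mult G (p ! i) (p ! j) \<longleftrightarrow> j = Suc i \<or> i = Suc j"
begin

text \<open>Bundle \<open>i\<close> joins the vertices at positions \<open>i - 1\<close> and
  \<open>i\<close>. The value 0 at positions 0 and \<open>Suc n\<close> supplies the modulus 0 of
  \<open>chain\<close> and makes \<open>flow\<close> vanish there.\<close>

definition thickness :: "nat \<Rightarrow> nat" where
  "thickness i = (if 1 \<le> i \<and> i \<le> n then mult G (p ! (i - 1)) (p ! i) else 0)"

text \<open>The net number of chips crossing bundle \<open>i\<close> from left to right when every
  vertex \<open>v\<close> fires \<open>f v\<close> times.\<close>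

definition flow :: "('v \<Rightarrow> int) \<Rightarrow> nat \<Rightarrow> int" where
  "flow f i = int (thickness i) * (f (p ! (i - 1)) - f (p ! i))"

lemma nth_inj: "inj_on ((!) p) {..n}"
  using distinct length_p by (auto simp: inj_on_def nth_eq_iff_index_eq)

lemma verts_nth: "verts G = (!) p ` {..n}"
  using set_p length_p by (auto simp: set_conv_nth less_Suc_eq_le)

lemma nth_eq_iff: "i \<le> n \<Longrightarrow> j \<le> n \<Longrightarrow> p ! i = p ! j \<longleftrightarrow> i = j"
  using nth_inj by (auto simp: inj_on_def)

lemma nth_in_verts: "i \<le> n \<Longrightarrow> p ! i \<in> verts G"
  by (simp add: verts_nth)

lemma sum_verts: "(\<Sum>v\<in>verts G. F v) = (\<Sum>i<Suc n. F (p ! i))"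
  by (simp add: verts_nth sum.reindex[OF nth_inj] lessThan_Suc_atMost)

lemma laplacian_nth:
  assumes "j \<le> n"
  shows "laplacian G f (p ! j) = flow f (Suc j) - flow f j"
proof -
  have sym: "mult G u v = mult G v u" for u v
    using multigraph by (simp add: is_multigraph_def)
  have "int (mult G (p ! j) (p ! k)) * (f (p ! j) - f (p ! k)) =
      (if k = Suc j then flow f (Suc j) else 0) + (if Suc k = j then - flow f j else 0)"
    if "k < Suc n" for k
  proof -
    consider "k = Suc j" | "Suc k = j" | "k \<noteq> Suc j" "Suc k \<noteq> j"
      by blast
    then show ?thesis
    proof cases
      case 3
      then show ?thesis
        using adjacent[of j k] assms that by auto
    qed (use that assms in \<open>auto simp: flow_def thickness_def sym[of "p ! j"] right_diff_distrib\<close>)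
  qed
  then have "laplacian G f (p ! j) = (\<Sum>k<Suc n. if k = Suc j then flow f (Suc j) else 0) +
      (\<Sum>k<Suc n. if Suc k = j then - flow f j else 0)"
    by (simp add: laplacian_def sum_verts sum.distrib del: sum.lessThan_Suc)
  moreover have "(\<Sum>k<Suc n. if k = Suc j then flow f (Suc j) else 0) = flow f (Suc j)"
    by (simp add: flow_def thickness_def del: sum.lessThan_Suc)
  moreover have "(\<Sum>k<Suc n. if Suc k = j then - flow f j else 0) = - flow f j"
  proof (cases j)
    case 0
    then show ?thesis
      by (simp add: flow_def thickness_def)
  next
    case (Suc i)
    then show ?thesis
      using assms by (simp del: sum.lessThan_Suc)
  qed
  ultimately show ?thesis
    by simp
qed

lemma sum_laplacian: "i \<le> Suc n \<Longrightarrow> (\<Sum>j<i. laplacian G f (p ! j)) = flow f i"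
proof (induction i)
  case 0
  then show ?case
    by (simp add: flow_def thickness_def)
qed (simp add: laplacian_nth)

text \<open>Firing changes the \<open>i\<close>-th partial sum by the flow through bundle
  \<open>i\<close>, a multiple of its thickness, and on a path these multiples can be prescribed
  independently. A chip on \<open>p ! a\<close> is a strict increase after \<open>a\<close>.\<close>

lemma linear_system_minus_point_iff:
  assumes s: "\<And>i. i \<le> Suc n \<Longrightarrow> s i = (\<Sum>j<i. D (p ! j))" and a: "a \<le> n"
  shows "linear_system G (\<lambda>v. D v - point (p ! a) v) \<noteq> {} \<longleftrightarrow>
    (\<exists>S. chain n thickness s S \<and> S a < S (Suc a))"
proof
  have point: "point (p ! a) (p ! j) = (if j = a then 1 else 0)" if "j \<le> n" for j
    using a that by (simp add: point_def nth_eq_iff)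
  {
    assume "linear_system G (\<lambda>v. D v - point (p ! a) v) \<noteq> {}"
    then obtain D' f where eff: "effective G D'"
      and D': "\<And>v. v \<in> verts G \<Longrightarrow> D' v = D v - point (p ! a) v - laplacian G f v"
      by (auto simp: linear_system_def lin_equiv_def)
    \<comment> \<open>The chip removed from \<open>p ! a\<close> is put back, so these are partial
      sums of an effective divisor equivalent to \<open>D\<close>.\<close>
    define S where "S i = (\<Sum>j<i. D' (p ! j) + point (p ! a) (p ! j))" for i
    have nonneg: "0 \<le> D' (p ! j)" if "j \<le> n" for j
      using eff that by (simp add: effective_def verts_nth)
    have "S i - s i = - flow f i" if "i \<le> Suc n" for i
    proof -
      have "S i = (\<Sum>j<i. D (p ! j) - laplacian G f (p ! j))"
        unfolding S_def using that by (intro sum.cong refl) (simp add: D' verts_nth)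
      then show ?thesis
        by (simp add: s that sum_subtractf sum_laplacian)
    qed
    then have "chain n thickness s S"
      using nonneg by (auto simp: chain_def flow_def S_def point_def)
    moreover have "S a < S (Suc a)"
      using nonneg[OF a] point[OF a] by (simp add: S_def)
    ultimately show "\<exists>S. chain n thickness s S \<and> S a < S (Suc a)"
      by blast
  }
  assume "\<exists>S. chain n thickness s S \<and> S a < S (Suc a)"
  then obtain S where mono: "\<And>i. i \<le> n \<Longrightarrow> S i \<le> S (Suc i)" and Sa: "S a < S (Suc a)"
    and "\<And>i. i \<le> Suc n \<Longrightarrow> \<exists>k. S i - s i = int (thickness i) * k"
    by (auto simp: chain_def dvd_def)
  then obtain k where k: "\<And>i. i \<le> Suc n \<Longrightarrow> S i - s i = int (thickness i) * k i"
    by metis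
  \<comment> \<open>Summing the quotients \<open>k\<close> along the path solves
    \<open>flow f i = s i - S i\<close> bundle by bundle.\<close>
  define f where "f v = (\<Sum>j<Suc (inv_into {..n} ((!) p) v). k j)" for v
  have f: "f (p ! i) = (\<Sum>j<Suc i. k j)" if "i \<le> n" for i
    using that by (simp add: f_def inv_into_f_f[OF nth_inj])
  have flow: "flow f i = s i - S i" if "i \<le> Suc n" for i
  proof (cases "1 \<le> i \<and> i \<le> n")
    case True
    then obtain i' where "i = Suc i'"
      by (cases i) auto
    then show ?thesis
      using k[OF that] f[of i] f[of i'] True by (simp add: flow_def algebra_simps)
  next
    case False
    then show ?thesis
      using k[OF that] by (auto simp: flow_def thickness_def)
  qed
  define D' where "D' v = (if v \<in> verts G then D v - point (p ! a) v - laplacian G f v else 0)" for v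
  have "0 \<le> D' (p ! j)" if "j \<le> n" for j
  proof -
    have "D (p ! j) = s (Suc j) - s j"
      using that by (simp add: s)
    then have "D' (p ! j) = S (Suc j) - S j - point (p ! a) (p ! j)"
      using that by (simp add: D'_def verts_nth laplacian_nth flow)
    then show ?thesis
      using mono[OF that] Sa point[OF that] by auto
  qed
  then have "effective G D'"
    by (auto simp: effective_def is_divisor_def D'_def verts_nth)
  moreover have "lin_equiv G (\<lambda>v. D v - point (p ! a) v) D'"
    by (auto simp: lin_equiv_def D'_def)
  ultimately show "linear_system G (\<lambda>v. D v - point (p ! a) v) \<noteq> {}"
    by (auto simp: linear_system_def)
qed

lemma positive_rank_iff_reach:
  "(\<exists>D. is_divisor G D \<and> div_degree G D = int d \<and> div_rank G D > 0) \<longleftrightarrow> reach thickness (Suc n) 0 d"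
proof
  assume "\<exists>D. is_divisor G D \<and> div_degree G D = int d \<and> div_rank G D > 0"
  then obtain D where D: "div_degree G D = int d" "div_rank G D > 0"
    by blast
  define s where "s i = (\<Sum>j<i. D (p ! j))" for i
  have "\<exists>S. chain n thickness s S \<and> S a < S (Suc a)" if "a \<le> n" for a
    using D(2) that linear_system_minus_point_iff[of s D a]
    by (auto simp: div_rank_pos_iff[OF multigraph] verts_nth s_def)
  then have "reach thickness (Suc n) 0 (nat (s (Suc n)))"
    by (intro chains_imp_reach) (simp_all add: thickness_def[of 0] thickness_def[of "Suc n"] s_def[of 0])
  moreover have "s (Suc n) = int d"
    using D(1) by (simp only: s_def div_degree_def sum_verts)
  ultimately show "reach thickness (Suc n) 0 d"
    by simp
next
  assume "reach thickness (Suc n) 0 d"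
  then obtain s where s: "s 0 = 0" "s (Suc n) = int d"
    and chains: "\<And>a. a \<le> n \<Longrightarrow> \<exists>S. chain n thickness s S \<and> S a < S (Suc a)"
    using reach_imp_chains by meson
  define D where "D v = (if v \<in> verts G then
      let i = inv_into {..n} ((!) p) v in s (Suc i) - s i else 0)" for v
  have "D (p ! i) = s (Suc i) - s i" if "i \<le> n" for i
    using that by (simp add: D_def verts_nth inv_into_f_f[OF nth_inj])
  then have sums: "s i = (\<Sum>j<i. D (p ! j))" if "i \<le> Suc n" for i
    using that s(1) by (simp add: sum_lessThan_telescope)
  have "div_rank G D > 0"
    using chains linear_system_minus_point_iff[OF sums]
    by (auto simp: div_rank_pos_iff[OF multigraph] verts_nth)
  moreover have "is_divisor G D"
    by (simp add: is_divisor_def D_def)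
  moreover have "div_degree G D = int d"
    using sums[of "Suc n"] s(2) by (simp only: div_degree_def sum_verts)
  ultimately show "\<exists>D. is_divisor G D \<and> div_degree G D = int d \<and> div_rank G D > 0"
    by blast
qed

text \<open>One chip on every vertex has positive rank; this bounds the gonality and hence the size
  of the table.\<close>

lemma reach_number_of_vertices: "reach thickness (Suc n) 0 (Suc n)"
proof -
  let ?D = "\<lambda>v. if v \<in> verts G then 1 else 0 :: int"
  have "(\<lambda>v. ?D v - point w v) \<in> linear_system G (\<lambda>v. ?D v - point w v)" if "w \<in> verts G" for w
    using that by (auto simp: linear_system_def lin_equiv_def effective_def is_divisor_def
        laplacian_def point_def intro: exI[of _ "\<lambda>_. 0"])
  then have "div_rank G ?D > 0"
    by (auto simp: div_rank_pos_iff[OF multigraph])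
  moreover have "is_divisor G ?D" and "div_degree G ?D = int (Suc n)"
    using set_p distinct_card[OF distinct] length_p by (simp_all add: is_divisor_def div_degree_def)
  ultimately show ?thesis
    using positive_rank_iff_reach by blast
qed

text \<open>The gonality is at most \<open>Suc n\<close>, so \<open>table_complete\<close> applies
  with \<open>N = Suc n\<close>; conversely \<open>table_sound\<close> turns the entry into a degree
  that is attained.\<close>

theorem gonality_eq_table: "gonality G = n + 2 - table thickness (Suc n) (Suc n) 0"
proof -
  let ?t = "table thickness (Suc n) (Suc n) 0"
  have gon: "gonality G = (LEAST d. reach thickness (Suc n) 0 d)"
    by (simp add: gonality_def positive_rank_iff_reach)
  have reach: "reach thickness (Suc n) 0 (gonality G)" and le: "gonality G \<le> Suc n"
    unfolding gon using reach_number_of_vertices by (auto intro: LeastI Least_le)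
  have "Suc (Suc n) - gonality G \<le> ?t"
    by (rule table_complete[OF reach]) (use le in simp)
  moreover from this have "reach thickness (Suc n) 0 (Suc (Suc n) - ?t)"
    using table_sound[of thickness "Suc n" "Suc n" 0] le by linarith
  then have "gonality G \<le> Suc (Suc n) - ?t"
    unfolding gon by (rule Least_le)
  ultimately show ?thesis
    by simp
qed

text \<open>The machine may start from either end of the path.\<close>

lemma rev: "listed_banana_path G (rev p) n"
proof
  show "0 < mult G (rev p ! i) (rev p ! j) \<longleftrightarrow> j = Suc i \<or> i = Suc j" if "i \<le> n" "j \<le> n" for i j
  proof -
    have "rev p ! i = p ! (n - i)" "rev p ! j = p ! (n - j)"
      using that by (simp_all add: rev_nth length_p)
    moreover have "n - j = Suc (n - i) \<or> n - i = Suc (n - j) \<longleftrightarrow> j = Suc i \<or> i = Suc j"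
      using that by linarith
    ultimately show ?thesis
      using adjacent[of "n - i" "n - j"] by simp
  qed
qed (use multigraph distinct set_p length_p in auto)

end

lemma banana_path_listed:
  assumes "banana_path G" and "card (verts G) = Suc n"
  obtains p where "listed_banana_path G p n"
proof -
  obtain p where p: "distinct p" "set p = verts G"
    and E: "simple_edges G = {{p ! i, p ! Suc i} | i. Suc i < length p}"
    and multi: "is_multigraph G"
    using assms(1) by (auto simp: banana_path_def is_path_graph_def)
  have len: "length p = Suc n"
    using p assms(2) distinct_card by metis
  have sym: "mult G u v = mult G v u" for u v
    using multi by (simp add: is_multigraph_def)
  have "0 < mult G (p ! i) (p ! j) \<longleftrightarrow> j = Suc i \<or> i = Suc j" if "i \<le> n" "j \<le> n" for i j
  proof -
    have "0 < mult G (p ! i) (p ! j) \<longleftrightarrow> {p ! i, p ! j} \<in> simple_edges G"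
      using sym by (auto simp: simple_edges_def doubleton_eq_iff)
    also have "\<dots> \<longleftrightarrow> (\<exists>k. Suc k < length p \<and> {p ! i, p ! j} = {p ! k, p ! Suc k})"
      unfolding E by blast
    also have "\<dots> \<longleftrightarrow> j = Suc i \<or> i = Suc j"
    proof
      show "\<exists>k. Suc k < length p \<and> {p ! i, p ! j} = {p ! k, p ! Suc k} \<Longrightarrow> j = Suc i \<or> i = Suc j"
        using that p(1) len by (auto simp: doubleton_eq_iff nth_eq_iff_index_eq)
      show "j = Suc i \<or> i = Suc j \<Longrightarrow> \<exists>k. Suc k < length p \<and> {p ! i, p ! j} = {p ! k, p ! Suc k}"
        using that len by (metis insert_commute less_Suc_eq_le)
    qed
    finally show ?thesis .
  qed
  then show ?thesis
    using that[of p] p multi len unfolding listed_banana_path_def by blast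
qed

section \<open>The program\<close>

text \<open>Register 0 holds the number \<open>N\<close> of vertices and register \<open>zero\<close> is never written. A vertex
  \<open>v\<close> is represented by the address \<open>v * N\<close> of its row, which avoids multiplication.\<close>

abbreviation (input) "one \<equiv> 2 :: nat"
abbreviation (input) "cap \<equiv> 3 :: nat"
abbreviation (input) "far \<equiv> 4 :: nat"
abbreviation (input) "zero \<equiv> 5 :: nat"
abbreviation (input) "cur \<equiv> 6 :: nat"
abbreviation (input) "prev \<equiv> 7 :: nat"
abbreviation (input) "nxt \<equiv> 8 :: nat"
abbreviation (input) "width \<equiv> 9 :: nat"
abbreviation (input) "old \<equiv> 10 :: nat"
abbreviation (input) "new \<equiv> 11 :: nat"
abbreviation (input) "cnt \<equiv> 12 :: nat"
abbreviation (input) "row \<equiv> 13 :: nat"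
abbreviation (input) "addr \<equiv> 14 :: nat"
abbreviation (input) "inner \<equiv> 15 :: nat"
abbreviation (input) "tmp \<equiv> 16 :: nat"
abbreviation (input) "acc \<equiv> 17 :: nat"
abbreviation (input) "aux \<equiv> 18 :: nat"
abbreviation (input) "gap \<equiv> 19 :: nat"
abbreviation (input) "target \<equiv> 20 :: nat"
abbreviation (input) "best \<equiv> 21 :: nat"
abbreviation (input) "left \<equiv> 22 :: nat"
abbreviation (input) "Move i j \<equiv> Add i j zero"

text \<open>Subtracting from 1 twice turns a multiplicity into 0 or 1, so \<open>acc\<close> counts
  neighbours and not edges.\<close>

definition "degree_loop = while_nonzero inner (block
  [Load tmp addr, Sub tmp one tmp, Sub tmp one tmp, Add acc acc tmp,
   Add addr addr one, Sub inner inner one])"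

text \<open>\<open>tmp\<close> is nonzero iff the vertex has at most one neighbour. Afterwards
  \<open>addr\<close> points just behind the matrix, where the table will start.\<close>

definition "find_end_loop = while_nonzero cnt (
  block [Move row addr, Const acc 0, Move inner 0] ;;
  degree_loop ;;
  block [Sub acc acc one, Sub tmp one acc] ;;
  if_nonzero tmp (block [Move cur row]) ;;
  block [Sub cnt cnt one])"

text \<open>The two truncated differences of \<open>row\<close> and \<open>prev\<close> add up to
  their distance, which is nonzero iff they differ.\<close>

definition "scan_loop = while_nonzero inner (
  block [Load tmp addr] ;;
  if_nonzero tmp (
    block [Sub acc row prev, Sub aux prev row, Add acc acc aux] ;;
    if_nonzero acc (block [Move nxt row, Move width tmp])) ;;
  block [Add addr addr one, Add row row 0, Sub inner inner one])"

text \<open>At the far end no next vertex is found and \<open>width\<close> stays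
  \<open>N + 2\<close>. Among the gaps up to \<open>N\<close> it divides only 0, just like the
  thickness 0 it replaces.\<close>

definition "scan =
  block [Move nxt cur, Move width far, Move addr cur, Const row 0, Move inner 0] ;; scan_loop"

text \<open>\<open>acc\<close> becomes \<open>descent gap target\<close>, and adding the truncated
  difference \<open>aux - best\<close> to \<open>best\<close> takes the maximum.\<close>

definition "entry_loop = while_nonzero inner (block
  [Load aux addr, Add tmp gap target, Sub tmp one tmp, Sub acc gap target, Add acc acc tmp,
   Sub aux aux acc, Sub aux aux best, Add best best aux,
   Add addr addr one, Add gap gap one, Sub inner inner one])"

text \<open>\<open>target\<close> visits only the multiples of \<open>width\<close>, so divisibility
  is never tested; the other entries remain 0 because the memory is fresh.\<close>

definition "stage_loop = while_nonzero left (
  block [Const best 0, Move addr old, Const gap 0, Move inner cap] ;;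
  entry_loop ;;
  block [Add addr new target, Store addr best, Add target target width, Sub left cap target])"

definition "search_loop = while_nonzero cnt (
  scan ;;
  block [Move prev cur, Move cur nxt, Add new old cap, Const target 0, Move left cap] ;;
  stage_loop ;;
  block [Move old new, Sub cnt cnt one])"

text \<open>The single store creates row 0 of the table: entry \<open>N + 1\<close> at gap 0.
  Setting \<open>prev\<close> to \<open>cur\<close> agrees with
  \<open>p ! (0 - 1) = p ! 0\<close>.\<close>

definition "gonality_program =
  block [Const one 1, Add cap 0 one, Add far cap one, Move cnt 0] ;;
  find_end_loop ;;
  block [Move old addr, Store old cap, Move prev cur, Move cnt 0] ;;
  search_loop ;;
  block [Load tmp old, Sub 0 cap tmp]"

definition constants :: "nat \<Rightarrow> (nat \<Rightarrow> nat) \<Rightarrow> bool" where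
  "constants N R \<longleftrightarrow> R 0 = N \<and> R one = 1 \<and> R cap = Suc N \<and> R far = Suc (Suc N) \<and> R zero = 0"

abbreviation unchanged :: "nat set \<Rightarrow> (nat \<Rightarrow> nat) \<Rightarrow> (nat \<Rightarrow> nat) \<Rightarrow> bool" where
  "unchanged A R R' \<equiv> \<forall>i. i \<notin> A \<longrightarrow> R' i = R i"

section \<open>Correctness and running times of the loops\<close>

lemma achieves_degree_loop:
  assumes "R one = 1" and "R inner = N"
  shows "achieves degree_loop (N * 8 + 1) (\<lambda>R' M'. M' = M \<and> R' addr = R addr + N \<and>
    R' acc = R acc + (\<Sum>i<N. min 1 (M (R addr + i))) \<and> unchanged {addr, inner, tmp, acc} R R') R M"
proof -
  let ?I = "\<lambda>k R' M'. M' = M \<and> R' addr = R addr + k \<and> R' inner = N - k \<and>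
    R' acc = R acc + (\<Sum>i<k. min 1 (M (R addr + i))) \<and> unchanged {addr, inner, tmp, acc} R R'"
  have "achieves degree_loop (N * (6 + 2) + 1) (?I N) R M"
    unfolding degree_loop_def
  proof (rule achieves_while[where I = ?I])
    fix k R' M'
    assume "k < N" and "?I k R' M'"
    then show "R' inner \<noteq> 0 \<and> achieves (block
        [Load tmp addr, Sub tmp one tmp, Sub tmp one tmp, Add acc acc tmp,
         Add addr addr one, Sub inner inner one]) 6 (?I (Suc k)) R' M'"
      using assms by (auto intro!: achieves_block_le)
  qed (use assms in auto)
  then show ?thesis
    by (rule achieves_mono) auto
qed

text \<open>The invariant is conditional, as no end may have been met yet; the vertex
  \<open>e\<close> discharges the condition on exit.\<close>

lemma achieves_find_end_loop:
  fixes M :: "nat \<Rightarrow> nat"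
  assumes const: "constants N R" and R: "R cnt = N" "R addr = 0"
    and "e < N" "deg e \<le> 1" and deg: "\<And>u. deg u = (\<Sum>v<N. min 1 (M (u * N + v)))"
  shows "achieves find_end_loop (N * (N * 8 + 11) + 1)
    (\<lambda>R' M'. M' = M \<and> R' addr = N * N \<and> constants N R' \<and>
      (\<exists>e<N. deg e \<le> 1 \<and> R' cur = e * N)) R M"
proof -
  let ?I = "\<lambda>k R' M'. M' = M \<and> R' addr = k * N \<and> constants N R' \<and> R' cnt = N - k \<and>
    ((\<exists>e<k. deg e \<le> 1) \<longrightarrow> (\<exists>e<k. deg e \<le> 1 \<and> R' cur = e * N))"
  have "achieves find_end_loop (N * ((N * 8 + 9) + 2) + 1) (?I N) R M"
    unfolding find_end_loop_def
  proof (rule achieves_while[where I = ?I])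
    fix k R' M'
    assume "k < N" and I: "?I k R' M'"
    have "achieves (block [Move row addr, Const acc 0, Move inner 0] ;;
        degree_loop ;;
        block [Sub acc acc one, Sub tmp one acc] ;;
        if_nonzero tmp (block [Move cur row]) ;;
        block [Sub cnt cnt one]) (N * 8 + 9) (?I (Suc k)) R' M"
    proof (rule achieves_block_seq[where B = "N * 8 + 6"], goal_cases)
      case 3
      let ?R = "R'(row := R' addr, acc := 0, inner := N)"
      have "achieves (degree_loop ;;
          block [Sub acc acc one, Sub tmp one acc] ;;
          if_nonzero tmp (block [Move cur row]) ;;
          block [Sub cnt cnt one]) (N * 8 + 6) (?I (Suc k)) ?R M"
      proof (rule achieves_seq_le[OF achieves_degree_loop[of ?R N M], where B = 5], goal_cases)
        case (3 S M')
        then have S: "M' = M" "S addr = Suc k * N" "S acc = deg k" "constants N S"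
          "S cnt = N - k" "S cur = R' cur" "S row = k * N"
          using I const by (auto simp: constants_def deg)
        show ?case
        proof (rule achieves_block_seq[where B = 3], goal_cases)
          case 3
          have "achieves (if_nonzero tmp (block [Move cur row]) ;; block [Sub cnt cnt one]) 3
              (?I (Suc k)) (S(acc := deg k - 1, tmp := 1 - (deg k - 1))) M" (is "achieves _ _ _ ?S _")
          proof (rule achieves_seq_le[where A = 2 and B = 1 and Q' = "\<lambda>S' M'. M' = M \<and>
              S' = (if deg k \<le> 1 then ?S(cur := k * N) else ?S)"], goal_cases)
            case 1
            have "achieves (if_nonzero tmp (block [Move cur row])) (Suc 1) (\<lambda>S' M'. M' = M \<and>
              S' = (if deg k \<le> 1 then ?S(cur := k * N) else ?S)) ?S M"
              by (rule achieves_if_nonzero)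
                (use S in \<open>auto intro!: achieves_block_le simp: constants_def\<close>)
            then show ?case
              by (simp add: numeral_2_eq_2)
          next
            case (2 S' M')
            show ?case
              by (rule achieves_block_le)
                (use 2 S I \<open>k < N\<close> in \<open>auto simp: constants_def less_Suc_eq\<close>)
          qed simp
          then show ?case
            using S by (simp add: constants_def)
        qed simp_all
      qed (use I in \<open>simp_all add: constants_def\<close>)
      then show ?case
        using I by (simp add: constants_def)
    qed simp_all
    then show "R' cnt \<noteq> 0 \<and> achieves (block [Move row addr, Const acc 0, Move inner 0] ;;
        degree_loop ;;
        block [Sub acc acc one, Sub tmp one acc] ;;
        if_nonzero tmp (block [Move cur row]) ;;
        block [Sub cnt cnt one]) (N * 8 + 9) (?I (Suc k)) R' M'"
      using I \<open>k < N\<close> by auto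
  qed (use assms in auto)
  then show ?thesis
    by (rule achieves_mono) (use assms(4,5) in auto)
qed

lemma achieves_scan:
  fixes M :: "nat \<Rightarrow> nat"
  assumes const: "constants N R"
    and good: "\<And>v. good v \<longleftrightarrow> M (R cur + v) \<noteq> 0 \<and> v * N \<noteq> R prev"
  shows "achieves scan (N * 13 + 6)
    (\<lambda>R' M'. M' = M \<and> unchanged {nxt, width, addr, row, inner, tmp, acc, aux} R R' \<and>
      (if \<exists>v<N. good v then \<exists>v<N. good v \<and> R' nxt = v * N \<and> R' width = M (R cur + v)
       else R' nxt = R cur \<and> R' width = Suc (Suc N))) R M"
proof -
  let ?I = "\<lambda>k R' M'. M' = M \<and> unchanged {nxt, width, addr, row, inner, tmp, acc, aux} R R' \<and>
    R' addr = R cur + k \<and> R' row = k * N \<and> R' inner = N - k \<and>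
      (if \<exists>v<k. good v then \<exists>v<k. good v \<and> R' nxt = v * N \<and> R' width = M (R cur + v)
       else R' nxt = R cur \<and> R' width = Suc (Suc N))"
  let ?R = "R(nxt := R cur, width := Suc (Suc N), addr := R cur, row := 0, inner := N)"
  have "achieves scan_loop (N * (11 + 2) + 1) (?I N) ?R M"
    unfolding scan_loop_def
  proof (rule achieves_while[where I = ?I])
    fix k R' M'
    assume "k < N" and I: "?I k R' M'"
    then have R': "M' = M" "R' addr = R cur + k" "R' row = k * N" "R' inner = N - k"
      "unchanged {nxt, width, addr, row, inner, tmp, acc, aux} R R'"
      by auto
    let ?S = "R'(tmp := M (R cur + k))"
    let ?P = "\<lambda>S. unchanged {nxt, width, tmp, acc, aux} R' S \<and>
      (if good k then S nxt = k * N \<and> S width = M (R cur + k)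
       else S nxt = R' nxt \<and> S width = R' width)"
    have "achieves (if_nonzero tmp (
          block [Sub acc row prev, Sub aux prev row, Add acc acc aux] ;;
          if_nonzero acc (block [Move nxt row, Move width tmp]))) (Suc 6)
        (\<lambda>S M'. M' = M \<and> ?P S) ?S M"
    proof (rule achieves_if_nonzero, goal_cases)
      case nonzero: 1
      show ?case
      proof (rule achieves_block_seq[where B = "Suc 2"], goal_cases)
        case 3
        show ?case
          unfolding case_prod_unfold
        proof (rule achieves_if_nonzero, goal_cases)
          case 1
          then show ?case
            by (intro achieves_block_le) (use nonzero R' const good in \<open>auto simp: constants_def\<close>)
        next
          case 2
          then show ?case
            using R' good by auto
        qed
      qed simp_all
    next
      case 2
      then show ?case
        using good by simp
    qed
    then have "achieves (if_nonzero tmp (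
          block [Sub acc row prev, Sub aux prev row, Add acc acc aux] ;;
          if_nonzero acc (block [Move nxt row, Move width tmp])) ;;
        block [Add addr addr one, Add row row 0, Sub inner inner one]) 10 (?I (Suc k)) ?S M"
    proof (rule achieves_seq_le[where B = 3], goal_cases)
      case (1 S M')
      show ?case
        by (rule achieves_block_le)
          (use 1 R' I const in \<open>auto simp: constants_def less_Suc_eq split: if_splits\<close>)
    qed simp
    then have "achieves (block [Load tmp addr] ;;
        if_nonzero tmp (
          block [Sub acc row prev, Sub aux prev row, Add acc acc aux] ;;
          if_nonzero acc (block [Move nxt row, Move width tmp])) ;;
        block [Add addr addr one, Add row row 0, Sub inner inner one]) 11 (?I (Suc k)) R' M"
      by (intro achieves_block_seq[where B = 10]) (use R' in simp_all)
    then show "R' inner \<noteq> 0 \<and> achieves (block [Load tmp addr] ;;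
        if_nonzero tmp (
          block [Sub acc row prev, Sub aux prev row, Add acc acc aux] ;;
          if_nonzero acc (block [Move nxt row, Move width tmp])) ;;
        block [Add addr addr one, Add row row 0, Sub inner inner one]) 11 (?I (Suc k)) R' M'"
      using R' \<open>k < N\<close> by simp
  qed auto
  then have "achieves scan (N * 13 + 6) (?I N) R M"
    unfolding scan_def
    by (intro achieves_block_seq[where B = "N * 13 + 1"]) (use const in \<open>simp_all add: constants_def\<close>)
  then show ?thesis
    by (rule achieves_mono) auto
qed

lemma achieves_entry_loop:
  fixes M :: "nat \<Rightarrow> nat"
  assumes "R one = 1" and "R inner = K" and "R best = 0" and "R gap = 0"
  shows "achieves entry_loop (K * 13 + 1) (\<lambda>R' M'. M' = M \<and>
    R' best = Max (insert 0 ((\<lambda>g. M (R addr + g) - descent g (R target)) ` {..<K})) \<and>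
    unchanged {addr, inner, tmp, acc, aux, gap, best} R R') R M"
proof -
  let ?I = "\<lambda>k R' M'. M' = M \<and> R' addr = R addr + k \<and> R' inner = K - k \<and> R' gap = k \<and>
    R' best = Max (insert 0 ((\<lambda>g. M (R addr + g) - descent g (R target)) ` {..<k})) \<and>
    unchanged {addr, inner, tmp, acc, aux, gap, best} R R'"
  have "achieves entry_loop (K * (11 + 2) + 1) (?I K) R M"
    unfolding entry_loop_def
  proof (rule achieves_while[where I = ?I])
    fix k R' M'
    assume "k < K" and I: "?I k R' M'"
    let ?f = "\<lambda>g. M (R addr + g) - descent g (R target)"
    have "insert 0 (?f ` {..<Suc k}) = insert (?f k) (insert 0 (?f ` {..<k}))"
      by (auto simp: lessThan_Suc)
    then have "Max (insert 0 (?f ` {..<Suc k})) = max (?f k) (Max (insert 0 (?f ` {..<k})))"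
      by (simp only:) (rule Max_insert, simp_all)
    \<comment> \<open>The maximum in the form in which truncated subtraction computes it.\<close>
    also have "\<dots> = Max (insert 0 (?f ` {..<k})) + (?f k - Max (insert 0 (?f ` {..<k})))"
      by linarith
    finally have max: "Max (insert 0 (?f ` {..<Suc k})) = R' best + (?f k - R' best)"
      using I by simp
    show "R' inner \<noteq> 0 \<and> achieves (block
        [Load aux addr, Add tmp gap target, Sub tmp one tmp, Sub acc gap target, Add acc acc tmp,
         Sub aux aux acc, Sub aux aux best, Add best best aux,
         Add addr addr one, Add gap gap one, Sub inner inner one]) 11 (?I (Suc k)) R' M'"
    proof
      have R': "M' = M" "R' addr = R addr + k" "R' inner = K - k" "R' gap = k"
        "unchanged {addr, inner, tmp, acc, aux, gap, best} R R'"
        using I by auto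
      then show "R' inner \<noteq> 0"
        using \<open>k < K\<close> by simp
      show "achieves (block
        [Load aux addr, Add tmp gap target, Sub tmp one tmp, Sub acc gap target, Add acc acc tmp,
         Sub aux aux acc, Sub aux aux best, Add best best aux,
         Add addr addr one, Add gap gap one, Sub inner inner one]) 11 (?I (Suc k)) R' M'"
        unfolding max
        by (rule achieves_block_le) (use R' assms(1) in \<open>simp_all add: descent_def\<close>)
    qed
  qed (use assms in auto)
  then show ?thesis
    by (rule achieves_mono) auto
qed

text \<open>There are \<open>N div w + 1\<close> multiples of the width up to \<open>N\<close>, at
  most \<open>Suc N\<close> of them, each costing one linear entry loop.\<close>

lemma achieves_stage_loop:
  fixes M :: "nat \<Rightarrow> nat"
  assumes const: "constants N R" and R: "R new = R old + Suc N" "R target = 0" "R left = Suc N"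
    and w: "0 < R width"
    and val: "\<And>h. val h = Max (insert 0 ((\<lambda>g. M (R old + g) - descent g h) ` {..<Suc N}))"
  shows "achieves stage_loop (Suc N * (Suc N * 13 + 9 + 2) + 1) (\<lambda>R' M'.
    unchanged {addr, inner, tmp, acc, aux, gap, target, best, left} R R' \<and>
    (\<forall>h\<le>N. M' (R new + h) = (if R width dvd h then val h else M (R new + h))) \<and>
    (\<forall>a. a < R new \<or> R new + N < a \<longrightarrow> M' a = M a)) R M"
proof -
  let ?w = "R width"
  \<comment> \<open>The memory after \<open>k\<close> rounds: the entries for the first
    \<open>k\<close> multiples of the width have been written.\<close>
  let ?J = "\<lambda>k. \<lambda>a. if a \<in> (\<lambda>i. R new + i * ?w) ` {..<k} then val (a - R new) else M a"
  let ?I = "\<lambda>k R' M'. M' = ?J k \<and> R' target = k * ?w \<and> R' left = Suc N - k * ?w \<and>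
    unchanged {addr, inner, tmp, acc, aux, gap, target, best, left} R R'"
  let ?K = "Suc (N div ?w)"
  have le: "k * ?w \<le> N" if "k < ?K" for k
    using that w by (simp add: less_Suc_eq_le less_eq_div_iff_mult_less_eq)
  have gt: "N < ?K * ?w"
    using w dividend_less_div_times[of ?w N] by (simp add: add.commute)
  have "achieves stage_loop (?K * ((Suc N * 13 + 9) + 2) + 1) (?I ?K) R M"
    unfolding stage_loop_def
  proof (rule achieves_while[where I = ?I])
    fix k R' M'
    assume k: "k < ?K" and I: "?I k R' M'"
    let ?R = "R'(best := 0, addr := R old, gap := 0, inner := Suc N)"
    \<comment> \<open>The new row starts right behind the old one, so the entries still to be read
      are intact.\<close>
    have same: "M' (R old + g) = M (R old + g)" if "g < Suc N" for g
      using I that R(1) by auto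
    have "achieves (entry_loop ;;
        block [Add addr new target, Store addr best, Add target target width, Sub left cap target])
        (Suc N * 13 + 5) (?I (Suc k)) ?R M'"
    proof (rule achieves_seq_le[OF achieves_entry_loop[of ?R "Suc N" M'], where B = 4], goal_cases)
      case (5 S M'')
      have "S best = val (k * ?w)"
        using 5 I same by (auto simp: val intro!: arg_cong[where f = Max] image_cong)
      moreover have "M'' = M'" "S new = R new" "S target = k * ?w" "S width = ?w" "S cap = Suc N"
        using 5 I const by (auto simp: constants_def)
      ultimately show ?case
        using 5 I by (intro achieves_block_le) (auto simp: fun_eq_iff lessThan_Suc add.commute)
    qed (use I const in \<open>auto simp: constants_def\<close>)
    then have "achieves (block [Const best 0, Move addr old, Const gap 0, Move inner cap] ;;
        entry_loop ;;
        block [Add addr new target, Store addr best, Add target target width, Sub left cap target])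
        (Suc N * 13 + 9) (?I (Suc k)) R' M'"
      by (intro achieves_block_seq[where B = "Suc N * 13 + 5"])
        (use I const in \<open>simp_all add: constants_def\<close>)
    then show "R' left \<noteq> 0 \<and> achieves (block [Const best 0, Move addr old, Const gap 0, Move inner cap] ;;
        entry_loop ;;
        block [Add addr new target, Store addr best, Add target target width, Sub left cap target])
        (Suc N * 13 + 9) (?I (Suc k)) R' M'"
      using I le[OF k] by simp
  qed (use R gt in auto)
  then show ?thesis
  proof (rule achieves_mono)
    show "?K * ((Suc N * 13 + 9) + 2) + 1 \<le> Suc N * (Suc N * 13 + 9 + 2) + 1"
      by (intro add_le_mono1 mult_le_mono1) simp
    fix R' M'
    assume I: "?I ?K R' M'"
    have "R new + h \<in> (\<lambda>i. R new + i * ?w) ` {..<?K} \<longleftrightarrow> ?w dvd h" if "h \<le> N" for h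
    proof
      assume "?w dvd h"
      then obtain i where i: "h = i * ?w"
        by (metis dvd_def mult.commute)
      then have "i < ?K"
        using that gt by (metis le_less_trans mult_less_cancel2)
      then show "R new + h \<in> (\<lambda>i. R new + i * ?w) ` {..<?K}"
        using i by blast
    qed auto
    then have "\<forall>h\<le>N. M' (R new + h) = (if ?w dvd h then val h else M (R new + h))"
      using I by simp
    moreover have "\<forall>a. a < R new \<or> R new + N < a \<longrightarrow> M' a = M a"
      using I le by (auto simp: not_less[symmetric])
    ultimately show "unchanged {addr, inner, tmp, acc, aux, gap, target, best, left} R R' \<and>
      (\<forall>h\<le>N. M' (R new + h) = (if ?w dvd h then val h else M (R new + h))) \<and>
      (\<forall>a. a < R new \<or> R new + N < a \<longrightarrow> M' a = M a)"
      using I by blast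
  qed
qed

section \<open>Recognizing ends and successors on the path, and the search along it\<close>

context listed_banana_path
begin

text \<open>This includes \<open>i = 0\<close>, where \<open>p ! (i - 1)\<close> is the vertex
  itself, never its own neighbour.\<close>

lemma next_vertex_iff:
  assumes "i \<le> n" and "v \<in> verts G"
  shows "0 < mult G (p ! i) v \<and> v \<noteq> p ! (i - 1) \<longleftrightarrow> i < n \<and> v = p ! Suc i"
proof -
  obtain k where k: "k \<le> n" "v = p ! k"
    using assms(2) by (auto simp: verts_nth)
  have "p ! k = p ! (i - 1) \<longleftrightarrow> k = i - 1"
    using assms(1) k(1) by (intro nth_eq_iff) simp_all
  moreover have "i < n \<Longrightarrow> p ! k = p ! Suc i \<longleftrightarrow> k = Suc i"
    using k(1) by (intro nth_eq_iff) simp_all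
  ultimately show ?thesis
    unfolding k(2) adjacent[OF assms(1) k(1)] using k(1) assms(1) by (cases "i < n"; simp; linarith)
qed

text \<open>An inner vertex has two distinct neighbours. The bound is an inequality so that the path
  with one vertex has an end too.\<close>

lemma card_neighbours_le_1_iff:
  assumes "i \<le> n"
  shows "card {v\<in>verts G. 0 < mult G (p ! i) v} \<le> 1 \<longleftrightarrow> i = 0 \<or> i = n"
proof -
  let ?A = "{v\<in>verts G. 0 < mult G (p ! i) v}"
  have fin: "finite ?A"
    using multigraph by (simp add: is_multigraph_def)
  have A: "p ! j \<in> ?A" if "j \<le> n" "j = Suc i \<or> i = Suc j" for j
    using adjacent[OF assms that(1)] that verts_nth by auto
  show ?thesis
  proof
    assume le: "card ?A \<le> 1"
    show "i = 0 \<or> i = n"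
    proof (rule ccontr)
      assume "\<not> (i = 0 \<or> i = n)"
      then have "i - 1 \<le> n" "i = Suc (i - 1)" "Suc i \<le> n"
        using assms by auto
      then have "p ! (i - 1) = p ! Suc i"
        using A[of "i - 1"] A[of "Suc i"] le card_le_Suc0_iff_eq[OF fin] by auto
      then show False
        using \<open>i - 1 \<le> n\<close> \<open>Suc i \<le> n\<close> by (simp add: nth_eq_iff)
    qed
  next
    assume "i = 0 \<or> i = n"
    then have "\<exists>k. ?A \<subseteq> {p ! k}"
    proof
      assume "i = 0"
      then have "?A \<subseteq> {p ! 1}"
        using adjacent[of 0] by (auto simp: verts_nth)
      then show ?thesis by blast
    next
      assume "i = n"
      then have "?A \<subseteq> {p ! (n - 1)}"
        using adjacent[of n] by (auto simp: verts_nth)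
      then show ?thesis by blast
    qed
    then obtain k where "?A \<subseteq> {p ! k}" ..
    then show "card ?A \<le> 1"
      using card_mono[of "{p ! k}" ?A] by simp
  qed
qed

end

lemma row_major_less: "u < N \<Longrightarrow> v < N \<Longrightarrow> u * N + v < N * N" for u v N :: nat
proof -
  assume "u < N" "v < N"
  then have "u * N + v < Suc u * N"
    by simp
  also have "\<dots> \<le> N * N"
    using \<open>u < N\<close> by (intro mult_le_mono1) simp
  finally show ?thesis .
qed

text \<open>Row \<open>i\<close> of the table occupies the \<open>N + 1\<close> cells from
  \<open>N * N + i * (N + 1)\<close>. The invariant keeps the matrix intact and all cells behind the
  current row zero.\<close>

lemma achieves_search_loop:
  fixes G :: "nat multigraph" and M :: "nat \<Rightarrow> nat"
  assumes path: "listed_banana_path G p n" and verts: "verts G = {..n}" and N: "N = Suc n"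
    and const: "constants N R" and R: "R cnt = N" "R cur = p ! 0 * N" "R prev = p ! 0 * N" "R old = N * N"
    and M: "\<And>u v. u < N \<Longrightarrow> v < N \<Longrightarrow> M (u * N + v) = mult G u v"
    "M (N * N) = Suc N" "\<And>a. N * N < a \<Longrightarrow> M a = 0"
  shows "achieves search_loop
    (N * ((N * 13 + 6) + (5 + ((Suc N * (Suc N * 13 + 9 + 2) + 1) + 2)) + 2) + 1)
    (\<lambda>R' M'. constants N R' \<and> M' (R' old) = table (listed_banana_path.thickness G p n) N N 0) R M"
proof -
  interpret listed_banana_path G p n
    by (fact path)
  let ?I = "\<lambda>i R' M'. constants N R' \<and> R' cnt = N - i \<and> (i \<le> n \<longrightarrow> R' cur = p ! i * N) \<and>
    R' prev = p ! (i - 1) * N \<and> R' old = N * N + i * Suc N \<and>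
    (\<forall>u<N. \<forall>v<N. M' (u * N + v) = mult G u v) \<and>
    (\<forall>g\<le>N. M' (R' old + g) = table thickness N i g) \<and> (\<forall>a>R' old + N. M' a = 0)"
  have "achieves search_loop
    (N * ((N * 13 + 6) + (5 + ((Suc N * (Suc N * 13 + 9 + 2) + 1) + 2)) + 2) + 1) (?I N) R M"
    unfolding search_loop_def
  proof (rule achieves_while[where I = ?I])
    fix i R' M'
    assume "i < N" and I: "?I i R' M'"
    then have i: "i \<le> n" and cur: "R' cur = p ! i * N" and const': "constants N R'"
      and prev: "R' prev = p ! (i - 1) * N" and old: "R' old = N * N + i * Suc N"
      and mat: "\<And>u v. u < N \<Longrightarrow> v < N \<Longrightarrow> M' (u * N + v) = mult G u v"
      and tab: "\<And>g. g \<le> N \<Longrightarrow> M' (R' old + g) = table thickness N i g"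
      and fresh: "\<And>a. R' old + N < a \<Longrightarrow> M' a = 0"
      using N by auto
    have pi: "p ! i < N"
      using nth_in_verts[OF i] verts N by simp
    define good where "good v \<longleftrightarrow> M' (R' cur + v) \<noteq> 0 \<and> v * N \<noteq> R' prev" for v
    have good: "good v \<longleftrightarrow> i < n \<and> v = p ! Suc i" if "v < N" for v
    proof -
      have "good v \<longleftrightarrow> 0 < mult G (p ! i) v \<and> v \<noteq> p ! (i - 1)"
        using mat[OF pi that] cur prev N by (simp add: good_def del: mult_Suc_right)
      also have "\<dots> \<longleftrightarrow> i < n \<and> v = p ! Suc i"
        by (rule next_vertex_iff[OF i]) (use that verts N in auto)
      finally show ?thesis .
    qed
    show "R' cnt \<noteq> 0 \<and> achieves (scan ;;
        block [Move prev cur, Move cur nxt, Add new old cap, Const target 0, Move left cap] ;;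
        stage_loop ;;
        block [Move old new, Sub cnt cnt one])
      ((N * 13 + 6) + (5 + ((Suc N * (Suc N * 13 + 9 + 2) + 1) + 2))) (?I (Suc i)) R' M'"
    proof (intro conjI, goal_cases)
      case 1
      then show ?case
        using I \<open>i < N\<close> by simp
    next
      case 2
      show ?case
      proof (rule achieves_seq_le[OF achieves_scan[OF const' good_def] _ order_refl], goal_cases)
        case (1 S M'')
        then have M'': "M'' = M'" and S: "constants N S" "S cnt = N - i" "S old = R' old"
          "S cur = p ! i * N"
          using I cur by (auto simp: constants_def)
        have next_: "(i < n \<longrightarrow> S nxt = p ! Suc i * N) \<and>
            S width = (if i < n then thickness (Suc i) else Suc (Suc N))"
        proof (cases "i < n")
          case True
          then have "p ! Suc i < N"
            using nth_in_verts[of "Suc i"] verts N by simp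
          then have "\<exists>v<N. good v" and "\<And>v. v < N \<Longrightarrow> good v \<longleftrightarrow> v = p ! Suc i"
            using good True by auto
          then have "S nxt = p ! Suc i * N" "S width = M' (R' cur + p ! Suc i)"
            using 1 by auto
          then show ?thesis
            using True mat[OF pi \<open>p ! Suc i < N\<close>] cur by (simp add: thickness_def)
        next
          case False
          then show ?thesis
            using 1 good by auto
        qed
        have "0 < S width"
          using next_ adjacent[of i "Suc i"] by (auto simp: thickness_def)
        \<comment> \<open>Past the last vertex the machine uses \<open>N + 2\<close> for the modulus
          0; on gaps up to \<open>N\<close> both have the single multiple 0.\<close>
        have width: "S width dvd h \<longleftrightarrow> thickness (Suc i) dvd h" if "h \<le> N" for h
          using next_ that i by (auto simp: thickness_def dest: dvd_imp_le)
        let ?S = "S(prev := S cur, cur := S nxt, new := S old + Suc N, target := 0, left := Suc N)"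
        have "achieves (stage_loop ;; block [Move old new, Sub cnt cnt one])
          ((Suc N * (Suc N * 13 + 9 + 2) + 1) + 2) (?I (Suc i)) ?S M'"
        proof (rule achieves_seq_le[OF achieves_stage_loop[of N ?S, OF _ _ _ _ _ refl] _ order_refl],
            goal_cases)
          case (6 S' M3)
          have S': "constants N S'" "S' cnt = N - i" "S' new = N * N + Suc i * Suc N"
            "S' prev = p ! i * N" "i < n \<longrightarrow> S' cur = p ! Suc i * N"
            using 6 S next_ old by (auto simp: constants_def)
          have new: "?S new = R' old + Suc N" "?S new = N * N + Suc i * Suc N"
            using S old by auto
          have "M3 (u * N + v) = mult G u v" if "u < N" "v < N" for u v
          proof -
            have "u * N + v < ?S new"
              using row_major_less[OF that] new(2) by linarith
            then show ?thesis
              using 6 mat[OF that] by simp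
          qed
          moreover have "M3 (N * N + Suc i * Suc N + h) = table thickness N (Suc i) h" if "h \<le> N" for h
          proof -
            have "(\<lambda>g. M' (?S old + g) - descent g h) ` {..<Suc N} =
                (\<lambda>g. table thickness N i g - descent g h) ` {..<Suc N}"
              by (intro image_cong refl) (use tab S in simp)
            \<comment> \<open>Unwritten cells of the new row are 0, as in the \<open>else\<close>
              branch of \<open>table\<close>.\<close>
            moreover have "M' (?S new + h) = 0"
              unfolding new(1) by (rule fresh) simp
            ultimately show ?thesis
              using 6 that width[OF that] unfolding new(2)[symmetric] table.simps by simp
          qed
          moreover have "M3 a = 0" if "N * N + Suc i * Suc N + N < a" for a
          proof -
            have "?S new + N < a"
              using that new(2) by simp
            moreover have "M' a = 0"
              by (rule fresh) (use \<open>?S new + N < a\<close> new(1) in linarith)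
            ultimately show ?thesis
              using 6 by simp
          qed
          ultimately show ?case
            using S' N by (intro achieves_block_le) (auto simp: constants_def simp del: table.simps)
        qed (use S \<open>0 < S width\<close> in \<open>simp_all add: constants_def\<close>)
        then show ?case
          unfolding M''
          by (intro achieves_block_seq[where B = "(Suc N * (Suc N * 13 + 9 + 2) + 1) + 2"])
            (use S in \<open>simp_all add: constants_def\<close>)
      qed
    qed
  next
    show "?I 0 R M"
      using R const M by (auto simp del: mult_Suc_right)
  qed auto
  then show ?thesis
    by (rule achieves_mono) (auto dest: spec[of _ 0] simp del: table.simps)
qed

section \<open>The complete program and its cubic time bound\<close>

lemma sum_min_1_eq_card:
  fixes f :: "nat \<Rightarrow> nat"
  shows "(\<Sum>v<N. min 1 (f v)) = card {v. v < N \<and> 0 < f v}"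
proof -
  have "(\<Sum>v<N. min 1 (f v)) = (\<Sum>v<N. if 0 < f v then 1 else 0)"
    by (intro sum.cong) auto
  also have "\<dots> = card ({..<N} \<inter> {v. 0 < f v})"
    by (simp add: sum.If_cases)
  also have "{..<N} \<inter> {v. 0 < f v} = {v. v < N \<and> 0 < f v}"
    by auto
  finally show ?thesis .
qed

definition search_time :: "nat \<Rightarrow> nat" where
  "search_time N = N * ((N * 13 + 6) + (5 + ((Suc N * (Suc N * 13 + 9 + 2) + 1) + 2)) + 2) + 1"

definition program_time :: "nat \<Rightarrow> nat" where
  "program_time N = 4 + (N * (N * 8 + 11) + 1 + (4 + (search_time N + 2)))"

lemma achieves_gonality_program:
  fixes G :: "nat multigraph"
  assumes G: "banana_path G" "verts G = {..n}" and N: "N = Suc n"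
    and R: "R = (\<lambda>i. if i = 0 then N else 0)"
    and M: "M = (\<lambda>a. if a < N * N then mult G (a div N) (a mod N) else 0)"
  shows "achieves gonality_program (program_time N) (\<lambda>R' M'. R' 0 = gonality G) R M"
proof -
  obtain p where "listed_banana_path G p n"
    using banana_path_listed[OF G(1), of n] G(2) by auto
  then interpret listed_banana_path G p n .
  have mat: "M (u * N + v) = mult G u v" if "u < N" "v < N" for u v
    using row_major_less[OF that] that by (simp add: M)
  define deg where "deg u = (\<Sum>v<N. min 1 (M (u * N + v)))" for u
  have deg: "deg (p ! i) \<le> 1 \<longleftrightarrow> i = 0 \<or> i = n" if "i \<le> n" for i
  proof -
    have "p ! i < N"
      using nth_in_verts[OF that] G(2) N by simp
    then have "{v. v < N \<and> 0 < M (p ! i * N + v)} = {v\<in>verts G. 0 < mult G (p ! i) v}"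
      using mat G(2) N by auto
    then show ?thesis
      using card_neighbours_le_1_iff[OF that] unfolding deg_def sum_min_1_eq_card by simp
  qed
  have p0: "p ! 0 < N" "deg (p ! 0) \<le> 1"
    using deg[of 0] nth_in_verts[of 0] G(2) N by auto
  \<comment> \<open>Whichever end the machine found, the path is listed anew so as to start
    there.\<close>
  have ends: "\<exists>q. listed_banana_path G q n \<and> q ! 0 = e" if "e < N" "deg e \<le> 1" for e
  proof -
    have "e \<in> verts G"
      using that(1) G(2) N by simp
    then obtain i where i: "i \<le> n" "e = p ! i"
      unfolding verts_nth by auto
    then have "i = 0 \<or> i = n"
      using deg that(2) by blast
    then show ?thesis
    proof
      assume "i = n"
      then have "rev p ! 0 = e"
        using i by (simp add: rev_nth length_p)
      then show ?thesis
        using rev by blast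
    qed (use i listed_banana_path_axioms in blast)
  qed
  let ?R = "R(one := 1, cap := Suc N, far := Suc (Suc N), cnt := N)"
  have "achieves (find_end_loop ;;
      block [Move old addr, Store old cap, Move prev cur, Move cnt 0] ;;
      search_loop ;;
      block [Load tmp old, Sub 0 cap tmp])
    (N * (N * 8 + 11) + 1 + (4 + (search_time N + 2))) (\<lambda>R' M'. R' 0 = gonality G) ?R M"
  proof (rule achieves_seq_le[OF achieves_find_end_loop[OF _ _ _ p0 deg_def] _ order_refl], goal_cases)
    case (4 S M')
    then obtain e where e: "e < N" "deg e \<le> 1" "S cur = e * N" and "M' = M"
      and S: "S addr = N * N" "constants N S"
      by blast
    then obtain q where q: "listed_banana_path G q n" "q ! 0 = e"
      using ends by blast
    let ?S = "S(old := N * N, prev := e * N, cnt := N)" and ?M = "M(N * N := Suc N)"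
    have below: "u * N + v \<noteq> N * N" if "u < N" "v < N" for u v
      using row_major_less[OF that] by simp
    have "achieves (search_loop ;; block [Load tmp old, Sub 0 cap tmp]) (search_time N + 2)
        (\<lambda>R' M'. R' 0 = gonality G) ?S ?M"
      unfolding search_time_def
    proof (rule achieves_seq_le[OF achieves_search_loop[OF q(1) G(2) N] _ order_refl], goal_cases)
      case (9 S' M')
      then show ?case
        using listed_banana_path.gonality_eq_table[OF q(1)] N
        by (intro achieves_block_le) (auto simp: constants_def)
    qed (use S e(3) q(2) mat below in \<open>auto simp: constants_def M\<close>)
    then show ?case
      unfolding \<open>M' = M\<close>
      by (intro achieves_block_seq[where B = "search_time N + 2"])
        (use S e(3) in \<open>simp_all add: constants_def\<close>)
  qed (simp_all add: R constants_def)
  then show ?thesis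
    unfolding gonality_program_def program_time_def
    by (intro achieves_block_seq[where B = "N * (N * 8 + 11) + 1 + (4 + (search_time N + 2))"])
      (simp_all add: R)
qed

theorem theorem1p1:
  "\<exists>(P :: instr list) (T :: nat \<Rightarrow> nat).
     (\<lambda>n. real (T n)) \<in> O(\<lambda>n. real n ^ 3) \<and>
     (\<forall>(n :: nat) (G :: nat multigraph).
        banana_path G \<and> verts G = {..n} \<longrightarrow>
        outputs_within P (input_config G) (T n) (gonality G))"
proof (intro exI conjI allI impI)
  show "(\<lambda>n. real (program_time (Suc n))) \<in> O(\<lambda>n. real n ^ 3)"
  \<comment> \<open>The constant is the sum 13 + 97 + 206 + 134 of the coefficients, since lower
    powers are at most the cube for \<open>1 \<le> n\<close>.\<close>
  proof (rule bigoI[where c = 450])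
    have "program_time (Suc n) \<le> 450 * n ^ 3" if "1 \<le> n" for n
    proof -
      have "n \<le> n * n" "n * n \<le> n * n * n" "1 \<le> n * n"
        using that by (auto simp: Suc_le_eq)
      moreover have "program_time (Suc n) = 13 * (n * n * n) + 97 * (n * n) + 206 * n + 134"
        by (simp add: program_time_def search_time_def algebra_simps)
      ultimately show ?thesis
        using that unfolding power3_eq_cube by linarith
    qed
    then have "real (program_time (Suc n)) \<le> real (450 * n ^ 3)" if "1 \<le> n" for n
      using that by (simp only: of_nat_le_iff)
    then show "\<forall>\<^sub>F n in at_top. norm (real (program_time (Suc n))) \<le> 450 * norm (real n ^ 3)"
      by (intro eventually_at_top_linorderI[of 1]) simp
  qed
next
  fix n and G :: "nat multigraph"
  assume "banana_path G \<and> verts G = {..n}"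
  then have "achieves gonality_program (program_time (Suc n)) (\<lambda>R' M'. R' 0 = gonality G)
      (fst (snd (input_config G))) (snd (snd (input_config G)))"
    by (intro achieves_gonality_program) (simp_all add: input_config_def Let_def)
  moreover have "input_config G = (0, fst (snd (input_config G)), snd (snd (input_config G)))"
    by (simp add: input_config_def Let_def)
  ultimately show "outputs_within (gonality_program 0) (input_config G) (program_time (Suc n)) (gonality G)"
    using outputs_within_achieves by (metis order_refl)
qed

end
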